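(* Let $\Bbbk$ be a field of characteristic zero and let $\mathcal{FK}_3$ be the Fomin-Kirillov algebra over $\Bbbk$, regarded as a bialgebra in ${}_H^H\mathcal{YD}$ for $H=\Bbbk S_3$. Then $\mathrm{H}^3_{\mathcal{YD}}(\mathcal{FK}_3,\Bbbk)=0$.
   Context: $\mathcal{FK}_3$ is the $\Bbbk$-algebra generated by $x_{(12)},x_{(13)},x_{(23)}$ with relations $x_{(12)}^2=x_{(13)}^2=x_{(23)}^2=0$, $x_{(12)}x_{(23)}=x_{(23)}x_{(13)}+x_{(13)}x_{(12)}$, $x_{(23)}x_{(12)}=x_{(13)}x_{(23)}+x_{(12)}x_{(13)}$. It is a graded bialgebra in the category of Yetter-Drinfeld modules over the symmetric group $S_3$ (i.e. over $\Bbbk S_3$), generated by the space $V_3$ with basis $x_{(12)},x_{(13)},x_{(23)}$ (primitive elements): the coaction is $x_\sigma\mapsto\sigma\otimes x_\sigma$, and a transposition $\sigma$ acts by $\sigma\cdot x_\tau=\chi(\sigma,\tau)x_{\sigma\tau\sigma^{-1}}$, where for $\tau=(ij)$, $i<j$, $\chi(\sigma,\tau)=1$ if $\sigma(i)<\sigma(j)$ and $-1$ otherwise. It is the Nichols algebra $\mathcal{B}(V_3)$, of dimension $12$. ${}_H^H\mathcal{YD}$ is the category of left-left Yetter-Drinfeld modules over $H$ (left $H$-modules and left $H$-comodules $V$, coaction $v\mapsto v_{-1}\otimes v_0$, with $(h_1v)_{-1}h_2\otimes(h_1v)_0=h_1v_{-1}\otimes h_2v_0$), monoidal with diagonal action and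 codiagonal coaction and braided by $c_{V,W}(v\otimes w)=v_{-1}w\otimes v_0$. For a bialgebra $B$ in ${}_H^H\mathcal{YD}$ with counit $\varepsilon_B$, $\mathrm{H}^n_{\mathcal{YD}}(B,\Bbbk)$ is the $n$-th cohomology of the complex with terms ${}_H^H\mathcal{YD}(B^{\otimes n},\Bbbk)$ (morphisms in ${}_H^H\mathcal{YD}$, $\Bbbk$ with trivial action and coaction), $n\ge0$, and the usual Hochschild differential with coefficients in $\Bbbk$ (a $B$-bimodule via $\varepsilon_B$); e.g. $\partial^2(f)=f\otimes\varepsilon_B-f(B\otimes m_B)+f(m_B\otimes B)-\varepsilon_B\otimes f$ and $\partial^3(f)=f\otimes\varepsilon_B-f(B\otimes B\otimes m_B)+f(B\otimes m_B\otimes B)-f(m_B\otimes B\otimes B)+\varepsilon_B\otimes f$. *)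

theory Defs
  imports
    Complex_Main
    "HOL-Library.Poly_Mapping"
    "HOL-Combinatorics.Perm"
begin

section \<open>The symmetric group on three letters\<close>

datatype idx = I1 | I2 | I3

instantiation idx :: linorder
begin

fun idx_nat :: "idx \<Rightarrow> nat" where
  "idx_nat I1 = 1" | "idx_nat I2 = 2" | "idx_nat I3 = 3"

definition less_eq_idx :: "idx \<Rightarrow> idx \<Rightarrow> bool" where "i \<le> j \<longleftrightarrow> idx_nat i \<le> idx_nat j"
definition less_idx :: "idx \<Rightarrow> idx \<Rightarrow> bool" where "i < j \<longleftrightarrow> idx_nat i < idx_nat j"

instance
proof
  fix x y z :: idx
  show "(x < y) = (x \<le> y \<and> \<not> y \<le> x)" by (auto simp: less_eq_idx_def less_idx_def)
  show "x \<le> x" by (simp add: less_eq_idx_def)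
  show "x \<le> y \<Longrightarrow> y \<le> z \<Longrightarrow> x \<le> z" by (simp add: less_eq_idx_def)
  show "x \<le> y \<Longrightarrow> y \<le> x \<Longrightarrow> x = y" by (cases x; cases y; simp add: less_eq_idx_def)
  show "x \<le> y \<or> y \<le> x" by (auto simp: less_eq_idx_def)
qed

end

lemma UNIV_idx: "(UNIV :: idx set) = {I1, I2, I3}"
  using idx.exhaust by auto

instance idx :: finite
  by standard (simp add: UNIV_idx)

type_synonym s3 = "idx perm"

lemma finite_UNIV_s3 [simp]: "finite (UNIV :: s3 set)"
proof (rule finite_imageD)
  show "finite ((apply :: s3 \<Rightarrow> _) ` UNIV)" by (rule finite_subset[OF subset_UNIV]) simp
  show "inj (apply :: s3 \<Rightarrow> _)" by (auto intro!: injI perm_eqI)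
qed

lemma s3_mult_inverse [simp]:
  fixes g :: "'a perm"
  shows "g * inverse g = 1" "inverse g * g = 1"
    "g * (inverse g * h) = h" "inverse g * (g * h) = h"
  by (simp_all add: mult.assoc[symmetric])

datatype tr = T12 | T13 | T23

fun tr_lo :: "tr \<Rightarrow> idx" where "tr_lo T12 = I1" | "tr_lo T13 = I1" | "tr_lo T23 = I2"
fun tr_hi :: "tr \<Rightarrow> idx" where "tr_hi T12 = I2" | "tr_hi T13 = I3" | "tr_hi T23 = I3"

definition tr_perm :: "tr \<Rightarrow> s3" where "tr_perm t = swap (tr_lo t) (tr_hi t)"

definition tr_conj :: "s3 \<Rightarrow> tr \<Rightarrow> tr" where
  "tr_conj g t = (THE u. tr_perm u = g * tr_perm t * inverse g)"

definition chi :: "s3 \<Rightarrow> tr \<Rightarrow> 'k::field" where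
  "chi g t = (if apply g (tr_lo t) < apply g (tr_hi t) then 1 else - 1)"

text \<open>The formula for \<open>chi\<close> is prescribed for transpositions \<open>g\<close> only. Read for every permutation
  \<open>g\<close> it is the unique extension to a group action on \<open>V\<^sub>3\<close>; see \<open>chi_tr_conj_mult\<close> below.\<close>

lemma tr_perm_inj: "tr_perm t = tr_perm u \<Longrightarrow> t = u"
proof -
  assume "tr_perm t = tr_perm u"
  then have "\<And>i. apply (tr_perm t) i = apply (tr_perm u) i" by simp
  from this[of I1] this[of I2] this[of I3] show ?thesis
    by (cases t; cases u; simp add: tr_perm_def)
qed

lemma tr_perm_square [simp]: "tr_perm t * tr_perm t = 1"
  by (simp add: tr_perm_def)

lemma swap_conj:
  fixes g :: "'a perm"
  shows "g * swap i j * inverse g = swap (apply g i) (apply g j)"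
proof -
  have "g * swap i j = swap (apply g i) (apply g j) * g"
  proof (rule perm_eqI)
    fix a
    show "apply (g * swap i j) a = apply (swap (apply g i) (apply g j) * g) a"
      by (cases "a = i"; cases "a = j"; simp add: apply_times apply_inj)
  qed
  then show ?thesis by (simp add: mult.assoc)
qed

lemma tr_perm_ex: "i \<noteq> j \<Longrightarrow> \<exists>u. tr_perm u = swap i j"
proof -
  assume "i \<noteq> j"
  then have "tr_perm T12 = swap i j \<or> tr_perm T13 = swap i j \<or> tr_perm T23 = swap i j"
    by (cases i; cases j; simp add: tr_perm_def swap_sym)
  then show ?thesis by blast
qed

lemma tr_lo_less_hi: "tr_lo t < tr_hi t"
  by (cases t) (simp_all add: less_idx_def)

lemma tr_perm_conj: "tr_perm (tr_conj g t) = g * tr_perm t * inverse g"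
proof -
  have "apply g (tr_lo t) \<noteq> apply g (tr_hi t)"
    using tr_lo_less_hi[of t] by (simp add: apply_inj)
  then obtain u where u: "tr_perm u = g * tr_perm t * inverse g"
    using tr_perm_ex unfolding tr_perm_def[of t] swap_conj by metis
  show ?thesis unfolding tr_conj_def
    by (rule theI) (use u tr_perm_inj in auto)
qed

lemma tr_conj_eqI: "tr_perm u = g * tr_perm t * inverse g \<Longrightarrow> tr_conj g t = u"
  by (metis tr_perm_conj tr_perm_inj)

lemma tr_conj_one [simp]: "tr_conj 1 t = t"
  by (rule tr_conj_eqI) simp

lemma tr_conj_mult: "tr_conj (g * h) t = tr_conj g (tr_conj h t)"
  by (rule tr_conj_eqI) (simp add: tr_perm_conj mult.assoc)

lemma chi_one [simp]: "chi 1 t = 1"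
  using tr_lo_less_hi[of t] by (simp add: chi_def)

lemma tr_conj_endpoints:
  "apply g (tr_lo t) < apply g (tr_hi t) \<Longrightarrow>
     tr_lo (tr_conj g t) = apply g (tr_lo t) \<and> tr_hi (tr_conj g t) = apply g (tr_hi t)"
  "\<not> apply g (tr_lo t) < apply g (tr_hi t) \<Longrightarrow>
     tr_lo (tr_conj g t) = apply g (tr_hi t) \<and> tr_hi (tr_conj g t) = apply g (tr_lo t)"
proof -
  let ?u = "tr_conj g t" and ?i = "apply g (tr_lo t)" and ?j = "apply g (tr_hi t)"
  have ne: "?i \<noteq> ?j" using tr_lo_less_hi[of t] by (simp add: apply_inj)
  have "swap (tr_lo ?u) (tr_hi ?u) = swap ?i ?j"
    using tr_perm_conj[of g t] unfolding tr_perm_def[of t] swap_conj by (simp add: tr_perm_def)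
  then have "affected (swap (tr_lo ?u) (tr_hi ?u)) = affected (swap ?i ?j)" by simp
  moreover have "tr_lo ?u \<noteq> tr_hi ?u" using tr_lo_less_hi[of ?u] by simp
  ultimately have "{tr_lo ?u, tr_hi ?u} = {?i, ?j}" using ne by (simp add: affected_swap)
  with tr_lo_less_hi[of ?u] show
    "?i < ?j \<Longrightarrow> tr_lo ?u = ?i \<and> tr_hi ?u = ?j"
    "\<not> ?i < ?j \<Longrightarrow> tr_lo ?u = ?j \<and> tr_hi ?u = ?i"
    by (auto simp: doubleton_eq_iff)
qed

lemma chi_tr_conj_mult: "chi (g * h) t = chi g (tr_conj h t) * chi h t"
proof (cases "apply h (tr_lo t) < apply h (tr_hi t)")
  case True
  with tr_conj_endpoints(1)[OF True] show ?thesis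
    by (simp add: chi_def apply_times)
next
  case False
  have "apply h (tr_lo t) \<noteq> apply h (tr_hi t)" using tr_lo_less_hi[of t] by (simp add: apply_inj)
  then have "apply g (apply h (tr_lo t)) \<noteq> apply g (apply h (tr_hi t))" by (simp add: apply_inj)
  with False tr_conj_endpoints(2)[OF False] show ?thesis
    by (auto simp: chi_def apply_times)
qed


section \<open>The Fomin-Kirillov algebra on three generators\<close>

datatype word = Word (letters: "tr list")

instantiation word :: monoid_add
begin
definition "0 = Word []"
definition "u + v = Word (letters u @ letters v)"
instance by standard (auto simp: zero_word_def plus_word_def)
end

lemma word_simps [simp]:
  "letters 0 = []" "letters (u + v) = letters u @ letters v"
  by (simp_all add: zero_word_def plus_word_def)

definition word_perm :: "word \<Rightarrow> s3" where
  "word_perm w = prod_list (map tr_perm (letters w))"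

lemma word_perm_simps [simp]:
  "word_perm 0 = 1" "word_perm (u + v) = word_perm u * word_perm v"
  by (simp_all add: word_perm_def)

text \<open>The free algebra on the three letters is the monoid algebra of the free monoid.\<close>

type_synonym 'k free_alg = "word \<Rightarrow>\<^sub>0 'k"

definition gen :: "tr \<Rightarrow> 'k::field free_alg" where
  "gen t = Poly_Mapping.single (Word [t]) 1"

definition fk3_relators :: "'k::field free_alg set" where
  "fk3_relators =
    {gen T12 * gen T12, gen T13 * gen T13, gen T23 * gen T23,
     gen T12 * gen T23 - (gen T23 * gen T13 + gen T13 * gen T12),
     gen T23 * gen T12 - (gen T13 * gen T23 + gen T12 * gen T13)}"

inductive_set fk3_ideal :: "'k::field free_alg set" where
  zero: "0 \<in> fk3_ideal"
| relator: "r \<in> fk3_relators \<Longrightarrow> r \<in> fk3_ideal"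
| add: "p \<in> fk3_ideal \<Longrightarrow> q \<in> fk3_ideal \<Longrightarrow> p + q \<in> fk3_ideal"
| left: "p \<in> fk3_ideal \<Longrightarrow> a * p \<in> fk3_ideal"
| right: "p \<in> fk3_ideal \<Longrightarrow> p * a \<in> fk3_ideal"

lemma fk3_ideal_uminus: "p \<in> fk3_ideal \<Longrightarrow> - p \<in> fk3_ideal"
  using fk3_ideal.left[of p "- 1"] by simp

lemma fk3_ideal_diff: "p \<in> fk3_ideal \<Longrightarrow> q \<in> fk3_ideal \<Longrightarrow> p - q \<in> fk3_ideal"
  using fk3_ideal.add[OF _ fk3_ideal_uminus] by fastforce

quotient_type (overloaded) 'k fk3 = "'k::field free_alg" / "\<lambda>p q. p - q \<in> fk3_ideal"
proof (rule equivpI)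
  show "reflp (\<lambda>p q :: 'k free_alg. p - q \<in> fk3_ideal)"
    by (simp add: reflpI fk3_ideal.zero)
  show "symp (\<lambda>p q :: 'k free_alg. p - q \<in> fk3_ideal)"
    by (rule sympI) (metis fk3_ideal_uminus minus_diff_eq)
  show "transp (\<lambda>p q :: 'k free_alg. p - q \<in> fk3_ideal)"
    by (rule transpI) (metis fk3_ideal.add add_diff_eq diff_add_cancel)
qed

lemma pm_single_induct [case_names zero add]:
  fixes p :: "'a \<Rightarrow>\<^sub>0 'b::comm_monoid_add"
  assumes "P 0" "\<And>p w c. P p \<Longrightarrow> P (p + Poly_Mapping.single w c)"
  shows "P p"
proof (induction p rule: Poly_Mapping.update_induct)
  case const
  show ?case by fact
next
  case (update f a b)
  have "Poly_Mapping.update a b f = f + Poly_Mapping.single a b"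
    using update(1) by (auto intro!: poly_mapping_eqI
        simp: Poly_Mapping.lookup_update lookup_add lookup_single in_keys_iff)
  then show ?case using assms(2)[OF update(3)] by simp
qed

lemma lookup_free_mult_zero:
  fixes p q :: "'k::field free_alg"
  shows "Poly_Mapping.lookup (p * q) 0 = Poly_Mapping.lookup p 0 * Poly_Mapping.lookup q 0"
proof (induction p rule: pm_single_induct)
  case (add p w c)
  have "Poly_Mapping.lookup (Poly_Mapping.single w c * q) 0
      = Poly_Mapping.lookup (Poly_Mapping.single w c) 0 * Poly_Mapping.lookup q 0"
  proof (induction q rule: pm_single_induct)
    case (add q v d)
    have "(w + v = 0) = (w = 0 \<and> v = 0)"
      by (cases w; cases v) (simp add: zero_word_def plus_word_def)
    then have "Poly_Mapping.lookup (Poly_Mapping.single w c * Poly_Mapping.single v d) 0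
      = Poly_Mapping.lookup (Poly_Mapping.single w c) 0 * Poly_Mapping.lookup (Poly_Mapping.single v d) 0"
      by (auto simp: mult_single lookup_single when_def)
    with add show ?case by (simp add: distrib_left lookup_add)
  qed simp
  with add show ?case by (simp add: distrib_right lookup_add)
qed simp

lemma fk3_ideal_counit:
  assumes "p \<in> fk3_ideal" shows "Poly_Mapping.lookup p 0 = 0"
  using assms
proof induction
  case (relator r)
  have "Poly_Mapping.lookup (gen t :: 'a free_alg) 0 = 0" for t
    by (simp add: gen_def lookup_single zero_word_def)
  with relator show ?case
    by (auto simp: fk3_relators_def lookup_add lookup_minus lookup_free_mult_zero)
qed (simp_all add: lookup_add lookup_free_mult_zero)

instantiation fk3 :: (field) ring_1
begin

lift_definition zero_fk3 :: "'a fk3" is 0 .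
lift_definition one_fk3 :: "'a fk3" is 1 .
lift_definition plus_fk3 :: "'a fk3 \<Rightarrow> 'a fk3 \<Rightarrow> 'a fk3" is "(+)"
  by (metis add_diff_add fk3_ideal.add)
lift_definition uminus_fk3 :: "'a fk3 \<Rightarrow> 'a fk3" is uminus
  by (metis fk3_ideal_uminus minus_diff_minus)
lift_definition minus_fk3 :: "'a fk3 \<Rightarrow> 'a fk3 \<Rightarrow> 'a fk3" is "(-)"
proof -
  fix p q r s :: "'a free_alg"
  assume "p - q \<in> fk3_ideal" "r - s \<in> fk3_ideal"
  then have "(p - q) - (r - s) \<in> fk3_ideal" by (rule fk3_ideal_diff)
  then show "p - r - (q - s) \<in> fk3_ideal" by (simp add: algebra_simps)
qed
lift_definition times_fk3 :: "'a fk3 \<Rightarrow> 'a fk3 \<Rightarrow> 'a fk3" is "(*)"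
proof -
  fix p q r s :: "'a free_alg"
  assume "p - q \<in> fk3_ideal" "r - s \<in> fk3_ideal"
  then have "(p - q) * r + q * (r - s) \<in> fk3_ideal"
    by (intro fk3_ideal.add fk3_ideal.left fk3_ideal.right)
  then show "p * r - q * s \<in> fk3_ideal" by (simp add: algebra_simps)
qed

instance
proof
  show "(0 :: 'a fk3) \<noteq> 1"
  proof (transfer, rule notI)
    assume "(0::'a free_alg) - 1 \<in> fk3_ideal"
    from fk3_ideal_counit[OF this] show False by (simp add: lookup_minus)
  qed
qed (transfer; simp add: algebra_simps fk3_ideal.zero)+

end

lift_definition fk3_scale :: "'k::field \<Rightarrow> 'k fk3 \<Rightarrow> 'k fk3"
  is "\<lambda>c p. Poly_Mapping.single 0 c * p"
  by (metis fk3_ideal.left right_diff_distrib)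

lift_definition fk3_x :: "tr \<Rightarrow> 'k::field fk3" is gen .

lemma fk3_relations:
  "fk3_x T12 * fk3_x T12 = 0" "fk3_x T13 * fk3_x T13 = 0" "fk3_x T23 * fk3_x T23 = 0"
  "fk3_x T12 * fk3_x T23 = fk3_x T23 * fk3_x T13 + fk3_x T13 * fk3_x T12"
  "fk3_x T23 * fk3_x T12 = fk3_x T13 * fk3_x T23 + fk3_x T12 * fk3_x T13"
  by (transfer; auto intro!: fk3_ideal.relator simp: fk3_relators_def)+

lemma single_zero_commute:
  "Poly_Mapping.single 0 c * p = p * (Poly_Mapping.single 0 c :: 'k::field free_alg)"
  by (induction p rule: pm_single_induct)
    (simp_all add: distrib_left distrib_right mult_single mult.commute)

lemma vector_space_fk3: "vector_space fk3_scale"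
proof
  fix a b :: 'a and x y :: "'a fk3"
  show "fk3_scale a (x + y) = fk3_scale a x + fk3_scale a y"
    by transfer (simp add: algebra_simps fk3_ideal.zero)
  show "fk3_scale (a + b) x = fk3_scale a x + fk3_scale b x"
    by transfer (simp add: algebra_simps fk3_ideal.zero single_add)
  show "fk3_scale a (fk3_scale b x) = fk3_scale (a * b) x"
    by transfer (simp add: mult.assoc[symmetric] mult_single fk3_ideal.zero)
  show "fk3_scale 1 x = x"
    by transfer (simp add: fk3_ideal.zero)
qed

interpretation fk3: vector_space fk3_scale by (rule vector_space_fk3)

lemma fk3_scale_mult:
  "fk3_scale c (x * y) = fk3_scale c x * y"
  "fk3_scale c (x * y) = x * fk3_scale c y"
proof -
  show "fk3_scale c (x * y) = fk3_scale c x * y"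
    by transfer (simp add: mult.assoc fk3_ideal.zero)
  show "fk3_scale c (x * y) = x * fk3_scale c y"
  proof transfer
    fix c :: 'a and p q :: "'a free_alg"
    have "Poly_Mapping.single 0 c * (p * q) = Poly_Mapping.single 0 c * p * q"
      by (simp only: mult.assoc)
    also have "\<dots> = p * Poly_Mapping.single 0 c * q"
      by (simp only: single_zero_commute)
    also have "\<dots> = p * (Poly_Mapping.single 0 c * q)"
      by (simp only: mult.assoc)
    finally show "Poly_Mapping.single 0 c * (p * q) - p * (Poly_Mapping.single 0 c * q) \<in> fk3_ideal"
      by (simp add: fk3_ideal.zero)
  qed
qed

definition lin_ext :: "('k::field \<Rightarrow> 'w \<Rightarrow> 'w::ab_group_add) \<Rightarrow> ('a \<Rightarrow> 'w) \<Rightarrow> ('a \<Rightarrow>\<^sub>0 'k) \<Rightarrow> 'w" where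
  "lin_ext s \<phi> p = (\<Sum>w\<in>Poly_Mapping.keys p. s (Poly_Mapping.lookup p w) (\<phi> w))"

lemma lookup_map_scale:
  fixes c :: "'k::field"
  shows "Poly_Mapping.lookup (Poly_Mapping.map ((*) c) p) k = c * Poly_Mapping.lookup p k"
  by (simp add: Poly_Mapping.map.rep_eq when_def)

context vector_space
begin

lemma lin_ext_superset:
  "finite A \<Longrightarrow> Poly_Mapping.keys p \<subseteq> A \<Longrightarrow>
    lin_ext scale \<phi> p = (\<Sum>w\<in>A. scale (Poly_Mapping.lookup p w) (\<phi> w))"
  unfolding lin_ext_def by (rule sum.mono_neutral_left) (auto simp: in_keys_iff)

lemma lin_ext_zero: "lin_ext scale \<phi> 0 = 0"
  by (simp add: lin_ext_def)

lemma lin_ext_single: "lin_ext scale \<phi> (Poly_Mapping.single w c) = scale c (\<phi> w)"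
  using lin_ext_superset[of "{w}" "Poly_Mapping.single w c" \<phi>] by simp

lemma lin_ext_add: "lin_ext scale \<phi> (p + q) = lin_ext scale \<phi> p + lin_ext scale \<phi> q"
proof -
  define A where "A = Poly_Mapping.keys p \<union> Poly_Mapping.keys q"
  have A: "finite A" "Poly_Mapping.keys p \<subseteq> A" "Poly_Mapping.keys q \<subseteq> A"
    "Poly_Mapping.keys (p + q) \<subseteq> A"
    using Poly_Mapping.keys_add[of p q] by (auto simp: A_def)
  show ?thesis
    unfolding lin_ext_superset[OF A(1,2)] lin_ext_superset[OF A(1,3)] lin_ext_superset[OF A(1,4)]
    by (simp add: lookup_add scale_left_distrib sum.distrib)
qed

lemma lin_ext_diff: "lin_ext scale \<phi> (p - q) = lin_ext scale \<phi> p - lin_ext scale \<phi> q"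
  using lin_ext_add[of \<phi> "p - q" q] unfolding diff_add_cancel by (rule eq_diff_eq[THEN iffD2, OF sym])

lemma lin_ext_map: "lin_ext scale \<phi> (Poly_Mapping.map ((*) c) p) = scale c (lin_ext scale \<phi> p)"
proof (induction p rule: pm_single_induct)
  case (add p w d)
  have "Poly_Mapping.map ((*) c) (p + Poly_Mapping.single w d)
      = Poly_Mapping.map ((*) c) p + Poly_Mapping.single w (c * d)"
    by (rule poly_mapping_eqI) (simp add: lookup_map_scale lookup_add lookup_single when_def distrib_left)
  with add show ?case by (simp add: lin_ext_add lin_ext_single scale_right_distrib)
next
  case zero
  have "Poly_Mapping.map ((*) c) 0 = (0 :: 'c \<Rightarrow>\<^sub>0 'a)"
    by (rule poly_mapping_eqI) (simp add: Poly_Mapping.map.rep_eq)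
  then show ?case by (simp add: lin_ext_zero)
qed

end

subsection \<open>Counit, action and coaction\<close>

lift_definition fk3_counit :: "'k::field fk3 \<Rightarrow> 'k" is "\<lambda>p. Poly_Mapping.lookup p 0"
proof -
  fix p q :: "'k free_alg"
  assume "p - q \<in> fk3_ideal"
  from fk3_ideal_counit[OF this] show "Poly_Mapping.lookup p 0 = Poly_Mapping.lookup q 0"
    by (simp add: lookup_minus)
qed

lemma fk3_counit_simps [simp]:
  "fk3_counit 0 = 0" "fk3_counit 1 = 1" "fk3_counit (fk3_x t) = 0"
  "fk3_counit (a + b) = fk3_counit a + fk3_counit b"
  "fk3_counit (a * b) = fk3_counit a * fk3_counit b"
  "fk3_counit (fk3_scale c a) = c * fk3_counit a"
proof -
  show "fk3_counit 0 = 0" by transfer simp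
  show "fk3_counit 1 = 1" by transfer simp
  show "fk3_counit (fk3_x t) = 0"
    by transfer (simp add: gen_def lookup_single zero_word_def)
  show "fk3_counit (a + b) = fk3_counit a + fk3_counit b"
    by transfer (rule lookup_add)
  show "fk3_counit (a * b) = fk3_counit a * fk3_counit b"
    by transfer (rule lookup_free_mult_zero)
  show "fk3_counit (fk3_scale c a) = c * fk3_counit a"
    by transfer (simp add: lookup_free_mult_zero)
qed

definition alg_eval :: "(tr \<Rightarrow> 'k fk3) \<Rightarrow> 'k::field free_alg \<Rightarrow> 'k fk3" where
  "alg_eval v = lin_ext fk3_scale (\<lambda>w. prod_list (map v (letters w)))"

lemma alg_eval_simps [simp]:
  "alg_eval v 0 = 0"
  "alg_eval v (p + q) = alg_eval v p + alg_eval v q"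
  "alg_eval v (p - q) = alg_eval v p - alg_eval v q"
  "alg_eval v (Poly_Mapping.single w c) = fk3_scale c (prod_list (map v (letters w)))"
  "alg_eval v (gen t) = v t"
  by (simp_all add: alg_eval_def gen_def fk3.lin_ext_zero fk3.lin_ext_add fk3.lin_ext_diff
      fk3.lin_ext_single)

lemma alg_eval_mult [simp]: "alg_eval v (p * q) = alg_eval v p * alg_eval v q"
proof (induction p rule: pm_single_induct)
  case (add p w c)
  have "alg_eval v (Poly_Mapping.single w c * q) = alg_eval v (Poly_Mapping.single w c) * alg_eval v q"
  proof (induction q rule: pm_single_induct)
    case (add q u d)
    then show ?case
      by (simp add: distrib_left mult_single fk3_scale_mult(1)[symmetric]
          fk3_scale_mult(2)[symmetric])
  qed simp
  with add show ?case by (simp add: distrib_right)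
qed simp

lemma alg_eval_ideal:
  assumes "\<And>r. r \<in> fk3_relators \<Longrightarrow> alg_eval v r = 0" and "p \<in> fk3_ideal"
  shows "alg_eval v p = 0"
  using assms(2) by induction (simp_all add: assms(1))

lemma alg_eval_act_relators:
  assumes "r \<in> fk3_relators"
  shows "alg_eval (\<lambda>t. fk3_scale (chi g t) (fk3_x (tr_conj g t))) r = 0"
proof -
  have ne: "apply g I1 \<noteq> apply g I2" "apply g I1 \<noteq> apply g I3" "apply g I2 \<noteq> apply g I3"
    by (simp_all add: apply_inj)
  have tc: "tr_conj g t = u" if "tr_lo u = apply g (tr_lo t) \<and> tr_hi u = apply g (tr_hi t)
       \<or> tr_lo u = apply g (tr_hi t) \<and> tr_hi u = apply g (tr_lo t)" for t u
    by (rule tr_conj_eqI) (use that in \<open>auto simp: tr_perm_def[of t] swap_conj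
        tr_perm_def[of u] swap_sym\<close>)
  note simps = chi_def less_idx_def fk3_relations fk3_scale_mult(1)[symmetric]
    fk3_scale_mult(2)[symmetric] fk3_relators_def
  show ?thesis
  proof (cases "apply g I1"; cases "apply g I2"; cases "apply g I3")
    assume g: "apply g I1 = I1" "apply g I2 = I2" "apply g I3 = I3"
    have "tr_conj g T12 = T12" "tr_conj g T13 = T13" "tr_conj g T23 = T23"
      by (rule tc; simp add: g)+
    with g assms show ?thesis by (auto simp: simps)
  next
    assume g: "apply g I1 = I1" "apply g I2 = I3" "apply g I3 = I2"
    have "tr_conj g T12 = T13" "tr_conj g T13 = T12" "tr_conj g T23 = T23"
      by (rule tc; simp add: g)+
    with g assms show ?thesis by (auto simp: simps)
  next
    assume g: "apply g I1 = I2" "apply g I2 = I1" "apply g I3 = I3"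
    have "tr_conj g T12 = T12" "tr_conj g T13 = T23" "tr_conj g T23 = T13"
      by (rule tc; simp add: g)+
    with g assms show ?thesis by (auto simp: simps)
  next
    assume g: "apply g I1 = I2" "apply g I2 = I3" "apply g I3 = I1"
    have "tr_conj g T12 = T23" "tr_conj g T13 = T12" "tr_conj g T23 = T13"
      by (rule tc; simp add: g)+
    with g assms show ?thesis by (auto simp: simps)
  next
    assume g: "apply g I1 = I3" "apply g I2 = I1" "apply g I3 = I2"
    have "tr_conj g T12 = T13" "tr_conj g T13 = T23" "tr_conj g T23 = T12"
      by (rule tc; simp add: g)+
    with g assms show ?thesis by (auto simp: simps)
  next
    assume g: "apply g I1 = I3" "apply g I2 = I2" "apply g I3 = I1"
    have "tr_conj g T12 = T23" "tr_conj g T13 = T13" "tr_conj g T23 = T12"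
      by (rule tc; simp add: g)+
    with g assms show ?thesis by (auto simp: simps)
  qed (use ne in auto)
qed

text \<open>\<open>fk3_act g\<close> is the algebra endomorphism with \<open>x\<^sub>t \<mapsto> chi g t \<cdot> x\<^bsub>gtg\<^sup>-\<^sup>1\<^esub>\<close>.\<close>

lift_definition fk3_act :: "s3 \<Rightarrow> 'k::field fk3 \<Rightarrow> 'k fk3"
  is "\<lambda>g. alg_eval (\<lambda>t. fk3_scale (chi g t) (fk3_x (tr_conj g t)))"
proof -
  fix g :: s3 and p q :: "'k free_alg"
  let ?v = "\<lambda>t. fk3_scale (chi g t) (fk3_x (tr_conj g t))"
  assume "p - q \<in> fk3_ideal"
  with alg_eval_act_relators have "alg_eval ?v (p - q) = 0" by (rule alg_eval_ideal)
  then show "alg_eval ?v p = alg_eval ?v q" by simp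
qed

lemma fk3_act_simps [simp]:
  "fk3_act g 0 = 0" "fk3_act g 1 = 1"
  "fk3_act g (a + b) = fk3_act g a + fk3_act g b"
  "fk3_act g (a * b) = fk3_act g a * fk3_act g b"
  "fk3_act g (fk3_scale c a) = fk3_scale c (fk3_act g a)"
  "fk3_act g (fk3_x t) = fk3_scale (chi g t) (fk3_x (tr_conj g t))"
proof -
  show "fk3_act g 0 = 0" "fk3_act g (a + b) = fk3_act g a + fk3_act g b"
    "fk3_act g (a * b) = fk3_act g a * fk3_act g b"
    "fk3_act g (fk3_x t) = fk3_scale (chi g t) (fk3_x (tr_conj g t))"
    by (transfer; simp)+
  show "fk3_act g 1 = 1"
    by transfer (simp add: Poly_Mapping.single_one[symmetric] del: Poly_Mapping.single_one)
  show "fk3_act g (fk3_scale c a) = fk3_scale c (fk3_act g a)"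
    by transfer (simp add: fk3_scale_mult(1)[symmetric])
qed

text \<open>As \<open>S\<^sub>3\<close> is finite, \<open>\<Sum>\<^sub>g g \<otimes> v\<^sub>g \<in> kS\<^sub>3 \<otimes> V\<close> is represented by the function \<open>g \<mapsto> v\<^sub>g\<close>;
  thus a coaction is a map \<open>V \<Rightarrow> s3 \<Rightarrow> V\<close>. The coaction of \<open>fk3\<close> is multiplicative with
  \<open>x\<^sub>t \<mapsto> t \<otimes> x\<^sub>t\<close>, so it sends a monomial \<open>w\<close> to \<open>word_perm w \<otimes> w\<close>.\<close>

definition word_component :: "'k::field free_alg \<Rightarrow> s3 \<Rightarrow> 'k free_alg" where
  "word_component p g = Poly_Mapping.mapp (\<lambda>w c. if word_perm w = g then c else 0) p"

lemma lookup_word_component: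
  "Poly_Mapping.lookup (word_component p g) w
    = (if word_perm w = g then Poly_Mapping.lookup p w else 0)"
  by (simp add: word_component_def lookup_mapp when_def in_keys_iff)

lemma word_component_simps [simp]:
  "word_component 0 g = 0"
  "word_component (p + q) g = word_component p g + word_component q g"
  "word_component (p - q) g = word_component p g - word_component q g"
  "word_component (Poly_Mapping.single w c) g
    = (if word_perm w = g then Poly_Mapping.single w c else 0)"
  by (auto intro!: poly_mapping_eqI
      simp: lookup_word_component lookup_add lookup_minus lookup_single when_def)

lemma word_component_mult:
  "word_component (p * q) g
    = (\<Sum>h\<in>UNIV. word_component p h * word_component q (inverse h * g))"
proof (induction p rule: pm_single_induct)
  case (add p w c)
  have "word_component (Poly_Mapping.single w c * q) g
    = (\<Sum>h\<in>UNIV. word_component (Poly_Mapping.single w c) h * word_component q (inverse h * g))"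
  proof (induction q rule: pm_single_induct)
    case (add q u d)
    have iff: "word_perm w * word_perm u = g \<longleftrightarrow> word_perm u = inverse (word_perm w) * g"
      by (metis s3_mult_inverse(3,4))
    have "(\<Sum>h\<in>UNIV. word_component (Poly_Mapping.single w c) h
           * word_component (Poly_Mapping.single u d) (inverse h * g))
      = (\<Sum>h\<in>UNIV. if word_perm w = h then Poly_Mapping.single w c
           * word_component (Poly_Mapping.single u d) (inverse h * g) else 0)"
      by (rule sum.cong) auto
    also have "\<dots> = word_component (Poly_Mapping.single w c * Poly_Mapping.single u d) g"
      using iff by (simp add: mult_single)
    finally show ?case
      using add by (simp add: distrib_left sum.distrib del: word_component_simps(4))
  qed simp
  with add show ?case by (simp add: distrib_right sum.distrib del: word_component_simps(4))
qed simp

lemma word_component_relators: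
  assumes "r \<in> fk3_relators" shows "word_component r g \<in> fk3_ideal"
proof -
  have gg: "gen t * gen u = Poly_Mapping.single (Word [t, u]) (1 :: 'a)" for t u
    by (simp add: gen_def mult_single plus_word_def)
  have wp: "word_perm (Word [T23, T13]) = word_perm (Word [T12, T23])"
    "word_perm (Word [T13, T12]) = word_perm (Word [T12, T23])"
    "word_perm (Word [T13, T23]) = word_perm (Word [T23, T12])"
    "word_perm (Word [T12, T13]) = word_perm (Word [T23, T12])"
    unfolding word_perm_def
    by (rule perm_eqI; case_tac a; simp add: tr_perm_def apply_times)+
  have "word_component r g = r \<or> word_component r g = 0"
    using assms unfolding fk3_relators_def gg by (auto simp: wp)
  then show ?thesis using assms by (auto intro: fk3_ideal.intros)
qed

lemma fk3_ideal_sum: "(\<And>i. i \<in> A \<Longrightarrow> f i \<in> fk3_ideal) \<Longrightarrow> sum f A \<in> fk3_ideal"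
  by (induction A rule: infinite_finite_induct) (auto intro: fk3_ideal.intros)

lemma word_component_ideal:
  assumes "p \<in> fk3_ideal" shows "word_component p g \<in> fk3_ideal"
  using assms
proof (induction arbitrary: g)
  case (relator r)
  then show ?case by (rule word_component_relators)
next
  case (left p a)
  then show ?case
    unfolding word_component_mult by (intro fk3_ideal_sum fk3_ideal.left)
next
  case (right p a)
  then show ?case
    unfolding word_component_mult by (intro fk3_ideal_sum fk3_ideal.right)
qed (simp_all add: fk3_ideal.zero fk3_ideal.add)

lift_definition fk3_coact :: "'k::field fk3 \<Rightarrow> s3 \<Rightarrow> 'k fk3" is word_component
  unfolding word_component_simps(3)[symmetric] by (rule word_component_ideal)

lemma
  fixes a b :: "'k::field fk3"
  shows fk3_coact_simps [simp]: "fk3_coact (0 :: 'k fk3) g = 0" "fk3_coact (1 :: 'k fk3) g = (if g = 1 then 1 else 0)"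
  "fk3_coact (a + b) g = fk3_coact a g + fk3_coact b g"
  "fk3_coact (fk3_scale c a) g = fk3_scale c (fk3_coact a g)"
  "fk3_coact (fk3_x t :: 'k fk3) g = (if g = tr_perm t then fk3_x t else 0)"
  and fk3_coact_mult:
  "fk3_coact (a * b) g = (\<Sum>h\<in>UNIV. fk3_coact a h * fk3_coact b (inverse h * g))"
proof -
  show "fk3_coact (0 :: 'k fk3) g = 0"
    by transfer (simp add: fk3_ideal.zero)
  show "fk3_coact (1 :: 'k fk3) g = (if g = 1 then 1 else 0)"
    by transfer (auto simp: Poly_Mapping.single_one[symmetric] fk3_ideal.zero simp del: Poly_Mapping.single_one)
  show "fk3_coact (a + b) g = fk3_coact a g + fk3_coact b g"
    by transfer (simp add: fk3_ideal.zero)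
  show "fk3_coact (fk3_x t :: 'k fk3) g = (if g = tr_perm t then fk3_x t else 0)"
    by transfer (auto simp: gen_def word_perm_def fk3_ideal.zero)
  have sum_abs: "abs_fk3 (\<Sum>h\<in>A. f h) = (\<Sum>h\<in>A. abs_fk3 (f h))" for A :: "s3 set" and f :: "_ \<Rightarrow> 'k free_alg"
    by (induction A rule: infinite_finite_induct)
      (simp_all add: zero_fk3.abs_eq[symmetric] plus_fk3.abs_eq[symmetric])
  show mult: "fk3_coact (a * b) g = (\<Sum>h\<in>UNIV. fk3_coact a h * fk3_coact b (inverse h * g))"
  proof -
    obtain p q where pq: "a = abs_fk3 p" "b = abs_fk3 q"
      by (metis Quotient3_abs_rep[OF Quotient3_fk3])
    show ?thesis
      by (simp add: pq times_fk3.abs_eq fk3_coact.abs_eq word_component_mult sum_abs)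
  qed
  have "word_component (Poly_Mapping.single 0 c * p) g = Poly_Mapping.single 0 c * word_component p g"
    for p :: "'k free_alg"
    by (rule poly_mapping_eqI)
      (simp add: mult_map_scale_conv_mult[symmetric] lookup_map_scale lookup_word_component)
  then show "fk3_coact (fk3_scale c a) g = fk3_scale c (fk3_coact a g)"
    by transfer (simp add: fk3_ideal.zero)
qed

lemma fk3_induct [case_names one x add scale]:
  fixes a :: "'k::field fk3"
  assumes one: "P 1" and x: "\<And>t a. P a \<Longrightarrow> P (fk3_x t * a)"
    and add: "\<And>a b. P a \<Longrightarrow> P b \<Longrightarrow> P (a + b)"
    and scale: "\<And>c a. P a \<Longrightarrow> P (fk3_scale c a)"
  shows "P a"
proof -
  have w: "P (abs_fk3 (Poly_Mapping.single (Word ts) 1))" for ts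
  proof (induction ts)
    case Nil
    then show ?case using one by (simp add: one_fk3_def zero_word_def[symmetric])
  next
    case (Cons t ts)
    have "Poly_Mapping.single (Word (t # ts)) 1 = gen t * Poly_Mapping.single (Word ts) (1::'k)"
      by (simp add: gen_def mult_single plus_word_def)
    then show ?case using x[OF Cons, of t] by (simp add: fk3_x_def times_fk3.abs_eq)
  qed
  have "P (abs_fk3 p)" for p
  proof (induction p rule: pm_single_induct)
    case zero
    then show ?case using scale[OF one, of 0] by (simp add: zero_fk3_def)
  next
    case (add p v c)
    have "abs_fk3 (Poly_Mapping.single v c) = fk3_scale c (abs_fk3 (Poly_Mapping.single v 1))"
      by (simp add: fk3_scale.abs_eq mult_single)
    then have "P (abs_fk3 (Poly_Mapping.single v c))"
      using scale[OF w[of "letters v"]] by simp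
    with add assms(3) show ?case by (simp add: plus_fk3.abs_eq[symmetric])
  qed
  then show ?thesis by (metis Quotient3_abs_rep[OF Quotient3_fk3])
qed


section \<open>Yetter-Drinfeld modules\<close>

text \<open>A \<open>kS\<^sub>3\<close>-module is a linear representation of \<open>S\<^sub>3\<close>. In the encoding of coactions above,
  \<open>coact v g\<close> is the \<open>v\<^sub>0\<close> belonging to \<open>v\<^bsub>-1\<^esub> = g\<close>. The Yetter-Drinfeld condition
  \<open>(h\<^sub>1v)\<^bsub>-1\<^esub>h\<^sub>2 \<otimes> (h\<^sub>1v)\<^sub>0 = h\<^sub>1v\<^bsub>-1\<^esub> \<otimes> h\<^sub>2v\<^sub>0\<close> is linear in \<open>h\<close>, so it is stated for
  group elements \<open>h\<close>; the last clause compares the coefficients of \<open>h * g\<close>.\<close>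

definition yd_module ::
  "('k::field \<Rightarrow> 'v \<Rightarrow> 'v::ab_group_add) \<Rightarrow> (s3 \<Rightarrow> 'v \<Rightarrow> 'v) \<Rightarrow> ('v \<Rightarrow> s3 \<Rightarrow> 'v) \<Rightarrow> bool" where
  "yd_module scale act coact \<longleftrightarrow>
    vector_space scale
    \<and> (\<forall>g. Vector_Spaces.linear scale scale (act g))
    \<and> (\<forall>v. act 1 v = v) \<and> (\<forall>g h v. act (g * h) v = act g (act h v))
    \<and> (\<forall>g. Vector_Spaces.linear scale scale (\<lambda>v. coact v g))
    \<and> (\<forall>v. (\<Sum>g\<in>UNIV. coact v g) = v)
    \<and> (\<forall>v g h. coact (coact v g) h = (if g = h then coact v g else 0))
    \<and> (\<forall>v g h. coact (act h v) (h * g * inverse h) = act h (coact v g))"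

definition yd_hom ::
  "('k::field \<Rightarrow> 'v \<Rightarrow> 'v::ab_group_add) \<Rightarrow> (s3 \<Rightarrow> 'v \<Rightarrow> 'v) \<Rightarrow> ('v \<Rightarrow> s3 \<Rightarrow> 'v) \<Rightarrow>
   ('k \<Rightarrow> 'w \<Rightarrow> 'w::ab_group_add) \<Rightarrow> (s3 \<Rightarrow> 'w \<Rightarrow> 'w) \<Rightarrow> ('w \<Rightarrow> s3 \<Rightarrow> 'w) \<Rightarrow> ('v \<Rightarrow> 'w) \<Rightarrow> bool" where
  "yd_hom scale1 act1 coact1 scale2 act2 coact2 f \<longleftrightarrow>
    Vector_Spaces.linear scale1 scale2 f
    \<and> (\<forall>g v. f (act1 g v) = act2 g (f v))
    \<and> (\<forall>v g. f (coact1 v g) = coact2 (f v) g)"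

definition triv_act :: "s3 \<Rightarrow> 'k::field \<Rightarrow> 'k" where "triv_act g c = c"
definition triv_coact :: "'k::field \<Rightarrow> s3 \<Rightarrow> 'k" where "triv_coact c g = (if g = 1 then c else 0)"

lemma vector_space_mult: "vector_space ((*) :: 'k::field \<Rightarrow> 'k \<Rightarrow> 'k)"
  by standard (simp_all add: algebra_simps)

lemma yd_module_triv: "yd_module (*) triv_act (triv_coact :: 'k::field \<Rightarrow> _)"
proof -
  have conj: "h * g * inverse h = 1 \<longleftrightarrow> g = 1" for g h :: s3
  proof
    assume "h * g * inverse h = 1"
    then have "inverse h * (h * g * inverse h) * h = 1" by simp
    then show "g = 1" by (simp add: mult.assoc)
  qed simp
  show ?thesis
    using vector_space_mult
    by (auto simp: yd_module_def Vector_Spaces.linear_iff triv_act_def triv_coact_def conj)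
qed

lemma yd_module_fk3: "yd_module fk3_scale fk3_act (fk3_coact :: 'k::field fk3 \<Rightarrow> _)"
proof -
  have x_coact: "fk3_coact (fk3_x t * a) g = fk3_x t * fk3_coact a (tr_perm t * g)"
    for t and a :: "'k fk3" and g
  proof -
    have "fk3_coact (fk3_x t * a) g
      = (\<Sum>h\<in>UNIV. if h = tr_perm t then fk3_x t * fk3_coact a (inverse h * g) else 0)"
      unfolding fk3_coact_mult by (rule sum.cong) auto
    then show ?thesis by (simp add: tr_perm_def)
  qed
  have a1: "fk3_act 1 v = v" for v :: "'k fk3"
    by (induction v rule: fk3_induct) simp_all
  have a2: "fk3_act (g * h) v = fk3_act g (fk3_act h v)" for g h and v :: "'k fk3"
    by (induction v rule: fk3_induct) (simp_all add: tr_conj_mult chi_tr_conj_mult mult.commute)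
  have c1: "(\<Sum>g\<in>UNIV. fk3_coact v g) = v" for v :: "'k fk3"
  proof (induction v rule: fk3_induct)
    case (x t a)
    have "(\<Sum>g\<in>UNIV. fk3_coact a (tr_perm t * g)) = (\<Sum>g\<in>UNIV. fk3_coact a g)"
      by (rule sum.reindex_bij_witness[where i = "\<lambda>g. tr_perm t * g" and j = "\<lambda>g. tr_perm t * g"])
        (simp_all add: mult.assoc[symmetric])
    with x show ?case by (simp add: x_coact sum_distrib_left[symmetric])
  qed (simp_all add: sum.distrib fk3.scale_sum_right[symmetric])
  have c2: "fk3_coact (fk3_coact v g) h = (if g = h then fk3_coact v g else 0)"
    for g h and v :: "'k fk3"
  proof (induction v arbitrary: g h rule: fk3_induct)
    case (x t a)
    have "tr_perm t * g = tr_perm t * h \<longleftrightarrow> g = h"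
      by (metis mult.assoc mult.left_neutral tr_perm_square)
    with x show ?case by (simp add: x_coact)
  qed auto
  have yd: "fk3_coact (fk3_act h v) (h * g * inverse h) = fk3_act h (fk3_coact v g)"
    for g h and v :: "'k fk3"
  proof (induction v arbitrary: g rule: fk3_induct)
    case one
    have "h * g * inverse h = 1 \<longleftrightarrow> g = 1"
      by (metis mult.assoc mult.right_neutral s3_mult_inverse(1,4))
    then show ?case by simp
  next
    case (x t a)
    have "tr_perm (tr_conj h t) * (h * g * inverse h) = h * (tr_perm t * g) * inverse h"
      by (simp add: tr_perm_conj mult.assoc)
    with x[of "tr_perm t * g"] show ?case
      by (simp add: x_coact fk3_scale_mult(1)[symmetric])
  qed simp_all
  show ?thesis
    using vector_space_fk3 a1 a2 c1 c2 yd by (simp add: yd_module_def Vector_Spaces.linear_iff)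
qed

lemma yd_hom_fk3_counit:
  "yd_hom fk3_scale fk3_act fk3_coact (*) triv_act triv_coact (fk3_counit :: 'k::field fk3 \<Rightarrow> 'k)"
proof -
  have "fk3_counit (fk3_act g v) = fk3_counit v" for g and v :: "'k fk3"
    by (induction v rule: fk3_induct) simp_all
  moreover have "fk3_counit (fk3_coact v g) = (if g = 1 then fk3_counit v else 0)"
    for g and v :: "'k fk3"
    by transfer (simp add: lookup_word_component)
  ultimately show ?thesis
    using vector_space_fk3 vector_space_mult
    by (simp add: yd_hom_def Vector_Spaces.linear_iff triv_act_def triv_coact_def)
qed


section \<open>The tensor algebra of FK3\<close>

text \<open>The elements of \<open>B\<^sup>\<otimes>\<^sup>n\<close>, for all \<open>n\<close> at once, form the direct sum \<open>T(B)\<close>: the free vector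
  space on all lists of elements of \<open>B\<close> modulo multilinearity. \<open>B\<^sup>\<otimes>\<^sup>n\<close> is the span of the classes of
  the lists of length \<open>n\<close>, and the empty list gives \<open>B\<^sup>\<otimes>\<^sup>0 = k\<close>.\<close>

inductive_set tensor_null :: "('k::field fk3 list \<Rightarrow>\<^sub>0 'k) set" where
  zero: "0 \<in> tensor_null"
| add: "p \<in> tensor_null \<Longrightarrow> q \<in> tensor_null \<Longrightarrow> p + q \<in> tensor_null"
| scale: "p \<in> tensor_null \<Longrightarrow> Poly_Mapping.map ((*) c) p \<in> tensor_null"
| slot_add: "Poly_Mapping.single (u @ (a + b) # v) 1
    - (Poly_Mapping.single (u @ a # v) 1 + Poly_Mapping.single (u @ b # v) 1) \<in> tensor_null"
| slot_scale: "Poly_Mapping.single (u @ fk3_scale c a # v) 1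
    - Poly_Mapping.single (u @ a # v) c \<in> tensor_null"

lemma tensor_null_uminus: "p \<in> tensor_null \<Longrightarrow> - p \<in> tensor_null"
proof -
  have "Poly_Mapping.map ((*) (- 1)) p = - p"
    by (rule poly_mapping_eqI) (simp add: lookup_map_scale)
  then show "p \<in> tensor_null \<Longrightarrow> - p \<in> tensor_null" using tensor_null.scale[of p "- 1"] by simp
qed

lemma tensor_null_diff: "p \<in> tensor_null \<Longrightarrow> q \<in> tensor_null \<Longrightarrow> p - q \<in> tensor_null"
  using tensor_null.add[OF _ tensor_null_uminus] by fastforce

quotient_type (overloaded) 'k fk3_tensor = "'k::field fk3 list \<Rightarrow>\<^sub>0 'k" / "\<lambda>p q. p - q \<in> tensor_null"
proof (rule equivpI)
  show "reflp (\<lambda>p q :: 'k fk3 list \<Rightarrow>\<^sub>0 'k. p - q \<in> tensor_null)"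
    by (simp add: reflpI tensor_null.zero)
  show "symp (\<lambda>p q :: 'k fk3 list \<Rightarrow>\<^sub>0 'k. p - q \<in> tensor_null)"
    by (rule sympI, drule tensor_null_uminus) simp
  show "transp (\<lambda>p q :: 'k fk3 list \<Rightarrow>\<^sub>0 'k. p - q \<in> tensor_null)"
    by (rule transpI, drule (1) tensor_null.add) simp
qed

instantiation fk3_tensor :: (field) ab_group_add
begin

lift_definition zero_fk3_tensor :: "'a fk3_tensor" is 0 .
lift_definition plus_fk3_tensor :: "'a fk3_tensor \<Rightarrow> 'a fk3_tensor \<Rightarrow> 'a fk3_tensor" is "(+)"
proof -
  fix p q r s :: "'a fk3 list \<Rightarrow>\<^sub>0 'a"
  assume "p - q \<in> tensor_null" "r - s \<in> tensor_null"
  then have "(p - q) + (r - s) \<in> tensor_null" by (rule tensor_null.add)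
  then show "p + r - (q + s) \<in> tensor_null" by (simp only: add_diff_add)
qed
lift_definition uminus_fk3_tensor :: "'a fk3_tensor \<Rightarrow> 'a fk3_tensor" is uminus
proof -
  fix p q :: "'a fk3 list \<Rightarrow>\<^sub>0 'a"
  assume "p - q \<in> tensor_null"
  then have "- (p - q) \<in> tensor_null" by (rule tensor_null_uminus)
  then show "- p - - q \<in> tensor_null" by (simp only: minus_diff_minus)
qed
lift_definition minus_fk3_tensor :: "'a fk3_tensor \<Rightarrow> 'a fk3_tensor \<Rightarrow> 'a fk3_tensor" is "(-)"
proof -
  fix p q r s :: "'a fk3 list \<Rightarrow>\<^sub>0 'a"
  assume "p - q \<in> tensor_null" "r - s \<in> tensor_null"
  then have "(p - q) - (r - s) \<in> tensor_null" by (rule tensor_null_diff)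
  then show "p - r - (q - s) \<in> tensor_null" by (simp add: algebra_simps)
qed

instance by standard (transfer; simp add: algebra_simps tensor_null.zero)+

end

lift_definition tensor_scale :: "'k::field \<Rightarrow> 'k fk3_tensor \<Rightarrow> 'k fk3_tensor"
  is "\<lambda>c. Poly_Mapping.map ((*) c)"
proof -
  fix c :: 'k and p q :: "'k fk3 list \<Rightarrow>\<^sub>0 'k"
  have "Poly_Mapping.map ((*) c) p - Poly_Mapping.map ((*) c) q = Poly_Mapping.map ((*) c) (p - q)"
    by (rule poly_mapping_eqI) (simp add: lookup_map_scale lookup_minus algebra_simps)
  then show "p - q \<in> tensor_null
      \<Longrightarrow> Poly_Mapping.map ((*) c) p - Poly_Mapping.map ((*) c) q \<in> tensor_null"
    by (simp add: tensor_null.scale)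
qed

lemma vector_space_tensor: "vector_space tensor_scale"
proof
  have eq: "p = q \<Longrightarrow> p - q \<in> tensor_null" for p q :: "'a fk3 list \<Rightarrow>\<^sub>0 'a"
    by (simp add: tensor_null.zero)
  fix a b :: 'a and x y :: "'a fk3_tensor"
  show "tensor_scale a (x + y) = tensor_scale a x + tensor_scale a y"
    by transfer (rule eq, rule poly_mapping_eqI, simp add: lookup_map_scale lookup_add algebra_simps)
  show "tensor_scale (a + b) x = tensor_scale a x + tensor_scale b x"
    by transfer (rule eq, rule poly_mapping_eqI, simp add: lookup_map_scale lookup_add algebra_simps)
  show "tensor_scale a (tensor_scale b x) = tensor_scale (a * b) x"
    by transfer (rule eq, rule poly_mapping_eqI, simp add: lookup_map_scale algebra_simps)
  show "tensor_scale 1 x = x"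
    by transfer (rule eq, rule poly_mapping_eqI, simp add: lookup_map_scale)
qed

interpretation tensor: vector_space tensor_scale by (rule vector_space_tensor)

definition tprod :: "'k::field fk3 list \<Rightarrow> 'k fk3_tensor" where
  "tprod bs = abs_fk3_tensor (Poly_Mapping.single bs 1)"

definition multilin :: "('k::field \<Rightarrow> 'w \<Rightarrow> 'w::ab_group_add) \<Rightarrow> ('k fk3 list \<Rightarrow> 'w) \<Rightarrow> bool" where
  "multilin s \<phi> \<longleftrightarrow>
    (\<forall>u v a b. \<phi> (u @ (a + b) # v) = \<phi> (u @ a # v) + \<phi> (u @ b # v)) \<and>
    (\<forall>u v c a. \<phi> (u @ fk3_scale c a # v) = s c (\<phi> (u @ a # v)))"

lemma multilin_tprod: "multilin tensor_scale tprod"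
  unfolding multilin_def
proof (intro conjI allI)
  fix u v :: "'a fk3 list" and a b :: "'a fk3" and c :: 'a
  show "tprod (u @ (a + b) # v) = tprod (u @ a # v) + tprod (u @ b # v)"
    unfolding tprod_def plus_fk3_tensor.abs_eq fk3_tensor.abs_eq_iff by (rule tensor_null.slot_add)
  show "tprod (u @ fk3_scale c a # v) = tensor_scale c (tprod (u @ a # v))"
    unfolding tprod_def tensor_scale.abs_eq fk3_tensor.abs_eq_iff
    by (simp add: tensor_null.slot_scale)
qed

lemma multilinD:
  assumes "multilin s \<phi>"
  shows "\<phi> (u @ (a + b) # v) = \<phi> (u @ a # v) + \<phi> (u @ b # v)"
    and "\<phi> (u @ fk3_scale c a # v) = s c (\<phi> (u @ a # v))"
  using assms unfolding multilin_def by blast+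

lemmas tprod_slot [simp] = multilinD[OF multilin_tprod]
lemmas tprod_slot_hd [simp] = multilinD[OF multilin_tprod, where u = "[]", unfolded append_Nil]

lemma lin_ext_tensor_null:
  assumes "vector_space s" "multilin s \<phi>" "p \<in> tensor_null"
  shows "lin_ext s \<phi> p = 0"
proof -
  interpret vector_space s by fact
  from assms(3) show ?thesis
  proof induction
    case (slot_add u a b v)
    have "\<phi> (u @ (a + b) # v) = \<phi> (u @ a # v) + \<phi> (u @ b # v)"
      using assms(2) by (rule multilinD)
    then show ?case by (simp add: lin_ext_add lin_ext_diff lin_ext_single)
  next
    case (slot_scale u c a v)
    have "\<phi> (u @ fk3_scale c a # v) = s c (\<phi> (u @ a # v))"
      using assms(2) by (rule multilinD)
    then show ?case by (simp add: lin_ext_diff lin_ext_single)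
  qed (simp_all add: lin_ext_zero lin_ext_add lin_ext_map)
qed

text \<open>The linear extension of \<open>b\<^sub>1 \<otimes> \<dots> \<otimes> b\<^sub>n \<mapsto> \<phi> [b\<^sub>1, \<dots>, b\<^sub>n]\<close>. The value \<open>0\<close> for non-multilinear
  \<open>\<phi>\<close> is junk: multilinearity is proved wherever \<open>tensor_ext\<close> is used.\<close>

definition tensor_ext ::
  "('k::field \<Rightarrow> 'w \<Rightarrow> 'w::ab_group_add) \<Rightarrow> ('k fk3 list \<Rightarrow> 'w) \<Rightarrow> 'k fk3_tensor \<Rightarrow> 'w" where
  "tensor_ext s \<phi> t = (if multilin s \<phi> then lin_ext s \<phi> (rep_fk3_tensor t) else 0)"

lemma tensor_ext_abs:
  assumes "vector_space s" "multilin s \<phi>"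
  shows "tensor_ext s \<phi> (abs_fk3_tensor p) = lin_ext s \<phi> p"
proof -
  have "rep_fk3_tensor (abs_fk3_tensor p) - p \<in> tensor_null"
    by (rule Quotient3_rep_abs[OF Quotient3_fk3_tensor]) (simp add: tensor_null.zero)
  from lin_ext_tensor_null[OF assms this]
  have "lin_ext s \<phi> (rep_fk3_tensor (abs_fk3_tensor p)) = lin_ext s \<phi> p"
    unfolding vector_space.lin_ext_diff[OF assms(1)] by simp
  then show ?thesis using assms(2) unfolding tensor_ext_def by simp
qed

lemma tensor_ext_tprod:
  assumes "vector_space s" "multilin s \<phi>"
  shows "tensor_ext s \<phi> (tprod bs) = \<phi> bs"
proof -
  interpret vector_space s by fact
  show ?thesis using tensor_ext_abs[OF assms] by (simp add: tprod_def lin_ext_single)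
qed

lemma linear_tensor_ext:
  assumes "vector_space s"
  shows "Vector_Spaces.linear tensor_scale s (tensor_ext s \<phi>)"
proof -
  interpret vector_space s by fact
  have abs: "\<exists>p. x = abs_fk3_tensor p" for x :: "'a fk3_tensor"
    by (metis Quotient3_abs_rep[OF Quotient3_fk3_tensor])
  have "tensor_ext s \<phi> (x + y) = tensor_ext s \<phi> x + tensor_ext s \<phi> y" for x y
  proof (cases "multilin s \<phi>")
    case True
    with abs[of x] abs[of y] show ?thesis
      by (auto simp: plus_fk3_tensor.abs_eq tensor_ext_abs[OF assms] lin_ext_add)
  qed (simp add: tensor_ext_def)
  moreover have "tensor_ext s \<phi> (tensor_scale c x) = s c (tensor_ext s \<phi> x)" for c x
  proof (cases "multilin s \<phi>")
    case True
    with abs[of x] show ?thesis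
      by (auto simp: tensor_scale.abs_eq tensor_ext_abs[OF assms] lin_ext_map)
  qed (simp add: tensor_ext_def)
  ultimately show ?thesis
    using assms vector_space_tensor by (simp add: Vector_Spaces.linear_iff)
qed

lemma tensor_induct [case_names tprod add scale]:
  fixes t :: "'k::field fk3_tensor"
  assumes tprod: "\<And>bs. P (tprod bs)" and add: "\<And>x y. P x \<Longrightarrow> P y \<Longrightarrow> P (x + y)"
    and scale: "\<And>c x. P x \<Longrightarrow> P (tensor_scale c x)"
  shows "P t"
proof -
  have "P (abs_fk3_tensor p)" for p
  proof (induction p rule: pm_single_induct)
    case zero
    then show ?case
      using scale[OF tprod, of 0] by (simp add: zero_fk3_tensor_def)
  next
    case (add p bs c)
    have "abs_fk3_tensor (Poly_Mapping.single bs c) = tensor_scale c (tprod bs)"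
      by (simp add: tensor_scale.abs_eq tprod_def)
    with scale[OF tprod[of bs], of c] have "P (abs_fk3_tensor (Poly_Mapping.single bs c))" by simp
    with add assms(2) show ?case by (simp add: plus_fk3_tensor.abs_eq[symmetric])
  qed
  then show ?thesis by (metis Quotient3_abs_rep[OF Quotient3_fk3_tensor])
qed

subsection \<open>Diagonal action and codiagonal coaction\<close>

definition tensor_act :: "s3 \<Rightarrow> 'k::field fk3_tensor \<Rightarrow> 'k fk3_tensor" where
  "tensor_act g = tensor_ext tensor_scale (\<lambda>bs. tprod (map (fk3_act g) bs))"

definition tensor_cons :: "'k::field fk3 \<Rightarrow> 'k fk3_tensor \<Rightarrow> 'k fk3_tensor" where
  "tensor_cons b = tensor_ext tensor_scale (\<lambda>bs. tprod (b # bs))"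

fun coact_list :: "'k::field fk3 list \<Rightarrow> s3 \<Rightarrow> 'k fk3_tensor" where
  "coact_list [] g = (if g = 1 then tprod [] else 0)"
| "coact_list (b # bs) g =
    (\<Sum>h\<in>UNIV. tensor_cons (fk3_coact b h) (coact_list bs (inverse h * g)))"

definition tensor_coact :: "'k::field fk3_tensor \<Rightarrow> s3 \<Rightarrow> 'k fk3_tensor" where
  "tensor_coact t g = tensor_ext tensor_scale (\<lambda>bs. coact_list bs g) t"

lemma multilin_tensor_act: "multilin tensor_scale (\<lambda>bs. tprod (map (fk3_act g) bs))"
  by (simp add: multilin_def)

lemma multilin_tensor_cons: "multilin tensor_scale (\<lambda>bs. tprod (b # bs))"
  using tprod_slot[of "b # u" for u] by (simp add: multilin_def)

lemma tensor_act_tprod [simp]: "tensor_act g (tprod bs) = tprod (map (fk3_act g) bs)"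
  by (simp add: tensor_act_def tensor_ext_tprod vector_space_tensor multilin_tensor_act)

lemma tensor_cons_tprod [simp]: "tensor_cons b (tprod bs) = tprod (b # bs)"
  by (simp add: tensor_cons_def tensor_ext_tprod vector_space_tensor multilin_tensor_cons)

lemma linear_tensor_act: "Vector_Spaces.linear tensor_scale tensor_scale (tensor_act g)"
  unfolding tensor_act_def by (rule linear_tensor_ext[OF vector_space_tensor])

lemma linear_tensor_cons: "Vector_Spaces.linear tensor_scale tensor_scale (tensor_cons b)"
  unfolding tensor_cons_def by (rule linear_tensor_ext[OF vector_space_tensor])

lemma linear_tensor_coact: "Vector_Spaces.linear tensor_scale tensor_scale (\<lambda>t. tensor_coact t g)"
  unfolding tensor_coact_def by (rule linear_tensor_ext[OF vector_space_tensor])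

lemmas tensor_act_linear [simp] =
  module_hom.zero[OF linear_tensor_act[unfolded linear_iff_module_hom]]
  module_hom.add[OF linear_tensor_act[unfolded linear_iff_module_hom]]
  module_hom.scale[OF linear_tensor_act[unfolded linear_iff_module_hom]]
  module_hom.sum[OF linear_tensor_act[unfolded linear_iff_module_hom]]

lemmas tensor_cons_linear [simp] =
  module_hom.zero[OF linear_tensor_cons[unfolded linear_iff_module_hom]]
  module_hom.add[OF linear_tensor_cons[unfolded linear_iff_module_hom]]
  module_hom.scale[OF linear_tensor_cons[unfolded linear_iff_module_hom]]
  module_hom.sum[OF linear_tensor_cons[unfolded linear_iff_module_hom]]

lemmas tensor_coact_linear [simp] =
  module_hom.zero[OF linear_tensor_coact[unfolded linear_iff_module_hom]]
  module_hom.add[OF linear_tensor_coact[unfolded linear_iff_module_hom]]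
  module_hom.scale[OF linear_tensor_coact[unfolded linear_iff_module_hom]]
  module_hom.sum[OF linear_tensor_coact[unfolded linear_iff_module_hom]]

lemma tensor_cons_linear_left [simp]:
  "tensor_cons (a + b) t = tensor_cons a t + tensor_cons b t"
  "tensor_cons (fk3_scale c a) t = tensor_scale c (tensor_cons a t)"
  "tensor_cons 0 t = 0"
proof -
  show "tensor_cons (a + b) t = tensor_cons a t + tensor_cons b t"
    by (induction t rule: tensor_induct) (simp_all add: tensor.scale_right_distrib algebra_simps)
  show sc: "tensor_cons (fk3_scale c a) t = tensor_scale c (tensor_cons a t)" for c a
    by (induction t rule: tensor_induct) (simp_all add: tensor.scale_right_distrib mult.commute)
  show "tensor_cons 0 t = 0"
    using sc[of 0 0] by simp
qed

lemma multilin_coact_list: "multilin tensor_scale (\<lambda>bs. coact_list bs g)"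
  unfolding multilin_def
proof (intro conjI allI)
  fix u v :: "'a fk3 list" and a b :: "'a fk3" and c :: 'a
  show "coact_list (u @ (a + b) # v) g = coact_list (u @ a # v) g + coact_list (u @ b # v) g"
    by (induction u arbitrary: g) (simp_all add: sum.distrib)
  show "coact_list (u @ fk3_scale c a # v) g = tensor_scale c (coact_list (u @ a # v) g)"
    by (induction u arbitrary: g) (simp_all add: tensor.scale_sum_right)
qed

lemma tensor_coact_tprod [simp]: "tensor_coact (tprod bs) g = coact_list bs g"
  by (simp add: tensor_coact_def tensor_ext_tprod vector_space_tensor multilin_coact_list)

lemma coact_list_cons:
  "tensor_coact (tensor_cons b t) g =
    (\<Sum>h\<in>UNIV. tensor_cons (fk3_coact b h) (tensor_coact t (inverse h * g)))"
  by (induction t rule: tensor_induct) (simp_all add: sum.distrib tensor.scale_sum_right)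

lemma tensor_act_cons: "tensor_act g (tensor_cons b t) = tensor_cons (fk3_act g b) (tensor_act g t)"
  by (induction t rule: tensor_induct) simp_all

lemma tensor_cons_sum_left: "tensor_cons (\<Sum>i\<in>A. f i) t = (\<Sum>i\<in>A. tensor_cons (f i) t)"
  by (induction A rule: infinite_finite_induct) simp_all

lemma yd_module_tensor: "yd_module tensor_scale tensor_act (tensor_coact :: 'k::field fk3_tensor \<Rightarrow> _)"
proof -
  note fk3 = yd_module_fk3[where 'k = 'k, unfolded yd_module_def]
  have "fk3_act 1 = (\<lambda>b :: 'k fk3. b)"
    using fk3 by auto
  then have a1: "tensor_act 1 t = t" for t :: "'k fk3_tensor"
    by (induction t rule: tensor_induct) simp_all
  have a2: "tensor_act (g * h) t = tensor_act g (tensor_act h t)" for g h and t :: "'k fk3_tensor"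
  proof -
    have "fk3_act (g * h) = (\<lambda>b :: 'k fk3. fk3_act g (fk3_act h b))"
      using fk3 by (simp add: fun_eq_iff)
    then show ?thesis by (induction t rule: tensor_induct) (simp_all add: o_def)
  qed
  have shift: "(\<Sum>g\<in>UNIV. F (h * g)) = (\<Sum>g\<in>UNIV. F g)" for h :: s3 and F :: "s3 \<Rightarrow> 'k fk3_tensor"
    by (rule sum.reindex_bij_witness[where i = "\<lambda>g. inverse h * g" and j = "\<lambda>g. h * g"]) simp_all
  have c1: "(\<Sum>g\<in>UNIV. tensor_coact t g) = t" for t :: "'k fk3_tensor"
  proof (induction t rule: tensor_induct)
    case (tprod bs)
    show ?case
    proof (induction bs)
      case (Cons b bs)
      have "(\<Sum>g\<in>UNIV. tensor_coact (tprod (b # bs)) g)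
        = (\<Sum>h\<in>UNIV. \<Sum>g\<in>UNIV. tensor_cons (fk3_coact b h) (coact_list bs (inverse h * g)))"
        by (simp, rule sum.swap)
      also have "\<dots> = (\<Sum>h\<in>UNIV. tensor_cons (fk3_coact b h) (\<Sum>g\<in>UNIV. coact_list bs g))"
        by (simp only: shift[of "\<lambda>g. tensor_cons (fk3_coact b h) (coact_list bs g)" for h] tensor_cons_linear(4))
      also have "\<dots> = tensor_cons (\<Sum>h\<in>UNIV. fk3_coact b h) (tprod bs)"
        using Cons by (simp add: tensor_cons_sum_left del: tensor_cons_tprod)
      finally show ?case using fk3 by simp
    qed simp
  qed (simp_all add: sum.distrib tensor.scale_sum_right[symmetric])
  have c2: "tensor_coact (tensor_coact t g) h = (if g = h then tensor_coact t g else 0)"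
    for g h and t :: "'k fk3_tensor"
  proof (induction t arbitrary: g h rule: tensor_induct)
    case (tprod bs)
    show ?case
    proof (induction bs arbitrary: g h)
      case (Cons b bs)
      have cc: "fk3_coact (fk3_coact b i) j = (if i = j then fk3_coact b i else 0)" for i j
        using fk3 by blast
      have ic: "tensor_cons (if P then a else 0) t = (if P then tensor_cons a t else 0)"
        for P and a :: "'k fk3" and t
        by simp
      have "tensor_coact (tensor_coact (tprod (b # bs)) g) h
        = (\<Sum>i\<in>UNIV. tensor_cons (fk3_coact b i)
            (tensor_coact (coact_list bs (inverse i * g)) (inverse i * h)))"
        by (simp add: coact_list_cons cc ic)
      also have "\<dots> = (\<Sum>i\<in>UNIV. tensor_cons (fk3_coact b i)
            (if g = h then coact_list bs (inverse i * g) else 0))"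
      proof -
        have "inverse i * g = inverse i * h \<longleftrightarrow> g = h" for i
          by (metis s3_mult_inverse(3))
        with Cons[unfolded tensor_coact_tprod] show ?thesis by simp
      qed
      finally show ?case by simp
    qed auto
  qed simp_all
  have yd: "tensor_coact (tensor_act h t) (h * g * inverse h) = tensor_act h (tensor_coact t g)"
    for g h and t :: "'k fk3_tensor"
  proof (induction t arbitrary: g rule: tensor_induct)
    case (tprod bs)
    show ?case
    proof (induction bs arbitrary: g)
      case Nil
      have "h * g * inverse h = 1 \<longleftrightarrow> g = 1"
        by (metis mult.assoc mult.right_neutral s3_mult_inverse(1,4))
      then show ?case by simp
    next
      case (Cons b bs)
      have "tensor_coact (tensor_act h (tprod (b # bs))) (h * g * inverse h)
        = (\<Sum>i\<in>UNIV. tensor_cons (fk3_coact (fk3_act h b) i)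
            (coact_list (map (fk3_act h) bs) (inverse i * (h * g * inverse h))))"
        by simp
      also have "\<dots> = (\<Sum>i\<in>UNIV. tensor_cons (fk3_coact (fk3_act h b) (h * i * inverse h))
            (coact_list (map (fk3_act h) bs) (h * (inverse i * g) * inverse h)))"
        by (rule sum.reindex_bij_witness[where i = "\<lambda>i. h * i * inverse h" and j = "\<lambda>i. inverse h * i * h"])
          (simp_all add: mult.assoc)
      also have "\<dots> = (\<Sum>i\<in>UNIV. tensor_act h (tensor_cons (fk3_coact b i) (coact_list bs (inverse i * g))))"
        using Cons fk3 by (simp add: tensor_act_cons)
      finally show ?case by simp
    qed
  qed simp_all
  show ?thesis
    using vector_space_tensor a1 a2 c1 c2 yd by (simp add: yd_module_def Vector_Spaces.linear_iff)
qed


section \<open>The cohomology of FK3 in Yetter-Drinfeld modules\<close>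

text \<open>Besides the Yetter-Drinfeld structure only the multiplication and the counit of \<open>B\<close> enter the
  complex below; the comultiplication (for which the \<open>x\<^sub>t\<close> are primitive) does not.

  The following are the maps \<open>B\<^sup>\<otimes>\<^sup>j \<otimes> m\<^sub>B \<otimes> B\<^sup>\<otimes>\<^sup>(\<^sup>n\<^sup>-\<^sup>j\<^sup>-\<^sup>2\<^sup>)\<close>, \<open>B\<^sup>\<otimes>\<^sup>(\<^sup>n\<^sup>-\<^sup>1\<^sup>) \<otimes> \<epsilon>\<^sub>B\<close> and \<open>\<epsilon>\<^sub>B \<otimes> B\<^sup>\<otimes>\<^sup>(\<^sup>n\<^sup>-\<^sup>1\<^sup>)\<close> on \<open>B\<^sup>\<otimes>\<^sup>n\<close>, extended by zero
  to the summands on which they make no sense.\<close>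

definition mult_list :: "nat \<Rightarrow> 'k::field fk3 list \<Rightarrow> 'k fk3_tensor" where
  "mult_list j bs = (if Suc j < length bs
    then tprod (take j bs @ (bs ! j * bs ! Suc j) # drop (Suc (Suc j)) bs) else 0)"

definition tensor_mult :: "nat \<Rightarrow> 'k::field fk3_tensor \<Rightarrow> 'k fk3_tensor" where
  "tensor_mult j = tensor_ext tensor_scale (mult_list j)"

definition tensor_counit_last :: "'k::field fk3_tensor \<Rightarrow> 'k fk3_tensor" where
  "tensor_counit_last = tensor_ext tensor_scale
    (\<lambda>bs. if bs = [] then 0 else tensor_scale (fk3_counit (last bs)) (tprod (butlast bs)))"

definition tensor_counit_first :: "'k::field fk3_tensor \<Rightarrow> 'k fk3_tensor" where
  "tensor_counit_first = tensor_ext tensor_scale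
    (\<lambda>bs. if bs = [] then 0 else tensor_scale (fk3_counit (hd bs)) (tprod (tl bs)))"

lemma multilin_mult_list: "multilin tensor_scale (mult_list j)"
  unfolding multilin_def
proof (intro conjI allI)
  fix u v :: "'a fk3 list" and a b :: "'a fk3" and c :: 'a
  consider d where "j = length u + Suc d" | "j = length u" | u' e where "u = u' @ [e]" "j = length u'"
    | "Suc j < length u"
  proof -
    assume *: "\<And>d. j = length u + Suc d \<Longrightarrow> thesis" "j = length u \<Longrightarrow> thesis"
      "\<And>u' e. u = u' @ [e] \<Longrightarrow> j = length u' \<Longrightarrow> thesis" "Suc j < length u \<Longrightarrow> thesis"
    consider "j > length u" | "j = length u" | "Suc j = length u" | "Suc j < length u" by linarith
    then show thesis
    proof cases
      case 1
      then show thesis using *(1)[of "j - length u - 1"] by simp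
    next
      case 3
      then have "u = butlast u @ [last u]" "j = length (butlast u)"
        by (cases u rule: rev_cases; simp)+
      then show thesis by (rule *(3))
    qed (use * in auto)
  qed
  then have "mult_list j (u @ (a + b) # v) = mult_list j (u @ a # v) + mult_list j (u @ b # v)
    \<and> mult_list j (u @ fk3_scale c a # v) = tensor_scale c (mult_list j (u @ a # v))"
  proof cases
    case (1 d)
    have "mult_list (length p + d) (p @ v) = (if Suc d < length v
      then tprod (p @ take d v @ (v ! d * v ! Suc d) # drop (Suc (Suc d)) v) else 0)" for p
      using nth_append_length_plus[of p v "Suc d"] by (simp add: mult_list_def)
    from this[of "u @ [x]" for x] 1 show ?thesis
      by (simp del: tprod_slot add: tprod_slot[where u = u
            and v = "take d v @ (v ! d * v ! Suc d) # drop (Suc (Suc d)) v"])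
  next
    case 2
    then show ?thesis
      by (cases v) (simp_all add: mult_list_def nth_append distrib_right fk3_scale_mult(1)[symmetric])
  next
    case (3 u' e)
    then show ?thesis
      by (simp add: mult_list_def distrib_left nth_append fk3_scale_mult(2)[symmetric])
  next
    case 4
    then show ?thesis
      using tprod_slot[where u = "take j u @ (u ! j * u ! Suc j) # drop (Suc (Suc j)) u" and v = v]
      by (simp add: mult_list_def nth_append)
  qed
  then show "mult_list j (u @ (a + b) # v) = mult_list j (u @ a # v) + mult_list j (u @ b # v)"
    and "mult_list j (u @ fk3_scale c a # v) = tensor_scale c (mult_list j (u @ a # v))" by simp_all
qed

lemma tensor_mult_tprod:
  "tensor_mult j (tprod bs) = (if Suc j < length bs
    then tprod (take j bs @ (bs ! j * bs ! Suc j) # drop (Suc (Suc j)) bs) else 0)"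
  by (simp add: tensor_mult_def tensor_ext_tprod vector_space_tensor multilin_mult_list)
    (simp add: mult_list_def)

lemma tensor_counit_last_tprod:
  "tensor_counit_last (tprod bs) =
    (if bs = [] then 0 else tensor_scale (fk3_counit (last bs)) (tprod (butlast bs)))"
proof -
  have "multilin tensor_scale
    (\<lambda>bs :: 'a fk3 list. if bs = [] then 0 else tensor_scale (fk3_counit (last bs)) (tprod (butlast bs)))"
    by (auto simp: multilin_def butlast_append tensor.scale_left_distrib
        tensor.scale_right_distrib mult.commute)
  then show ?thesis
    by (simp add: tensor_counit_last_def tensor_ext_tprod vector_space_tensor)
qed

lemma tensor_counit_first_tprod:
  "tensor_counit_first (tprod bs) =
    (if bs = [] then 0 else tensor_scale (fk3_counit (hd bs)) (tprod (tl bs)))"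
proof -
  have "multilin tensor_scale
    (\<lambda>bs :: 'a fk3 list. if bs = [] then 0 else tensor_scale (fk3_counit (hd bs)) (tprod (tl bs)))"
    by (auto simp: multilin_def hd_append tl_append tensor.scale_left_distrib
        tensor.scale_right_distrib mult.commute split: list.split)
  then show ?thesis
    by (simp add: tensor_counit_first_def tensor_ext_tprod vector_space_tensor)
qed

lemma linear_tensor_mult: "Vector_Spaces.linear tensor_scale tensor_scale (tensor_mult j)"
  unfolding tensor_mult_def by (rule linear_tensor_ext[OF vector_space_tensor])

lemma linear_tensor_counit_last: "Vector_Spaces.linear tensor_scale tensor_scale tensor_counit_last"
  unfolding tensor_counit_last_def by (rule linear_tensor_ext[OF vector_space_tensor])

lemma linear_tensor_counit_first: "Vector_Spaces.linear tensor_scale tensor_scale tensor_counit_first"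
  unfolding tensor_counit_first_def by (rule linear_tensor_ext[OF vector_space_tensor])

text \<open>A linear form on \<open>B\<^sup>\<otimes>\<^sup>n\<close> is identified with its extension by zero to \<open>T(B)\<close>.\<close>

definition fk3_cochains :: "nat \<Rightarrow> ('k::field fk3_tensor \<Rightarrow> 'k) set" where
  "fk3_cochains n = {f. yd_hom tensor_scale tensor_act tensor_coact (*) triv_act triv_coact f
    \<and> (\<forall>bs. length bs \<noteq> n \<longrightarrow> f (tprod bs) = 0)}"

text \<open>\<open>\<partial>\<^sup>n f = f \<otimes> \<epsilon>\<^sub>B + (\<Sum>j<n. (-1)\<^sup>n\<^sup>-\<^sup>j f(B\<^sup>\<otimes>\<^sup>j \<otimes> m\<^sub>B \<otimes> B\<^sup>\<otimes>\<^sup>n\<^sup>-\<^sup>1\<^sup>-\<^sup>j)) + (-1)\<^sup>n\<^sup>+\<^sup>1 \<epsilon>\<^sub>B \<otimes> f\<close>\<close>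

definition fk3_diff :: "nat \<Rightarrow> ('k::field fk3_tensor \<Rightarrow> 'k) \<Rightarrow> 'k fk3_tensor \<Rightarrow> 'k" where
  "fk3_diff n f t = f (tensor_counit_last t)
    + (\<Sum>j<n. (- 1) ^ (n - j) * f (tensor_mult j t))
    + (- 1) ^ (n + 1) * f (tensor_counit_first t)"

definition fk3_cocycles :: "nat \<Rightarrow> ('k::field fk3_tensor \<Rightarrow> 'k) set" where
  "fk3_cocycles n = {f \<in> fk3_cochains n. \<forall>t. fk3_diff n f t = 0}"

definition fk3_coboundaries :: "nat \<Rightarrow> ('k::field fk3_tensor \<Rightarrow> 'k) set" where
  "fk3_coboundaries n = (case n of 0 \<Rightarrow> {\<lambda>t. 0} | Suc m \<Rightarrow> fk3_diff m ` fk3_cochains m)"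

definition fk3_cohomologous :: "nat \<Rightarrow> (('k::field fk3_tensor \<Rightarrow> 'k) \<times> ('k fk3_tensor \<Rightarrow> 'k)) set" where
  "fk3_cohomologous n = {(f, g). f \<in> fk3_cocycles n \<and> g \<in> fk3_cocycles n
    \<and> (\<lambda>t. f t - g t) \<in> fk3_coboundaries n}"

definition fk3_cohomology :: "nat \<Rightarrow> ('k::field fk3_tensor \<Rightarrow> 'k) set set" where
  "fk3_cohomology n = fk3_cocycles n // fk3_cohomologous n"

definition fk3_cohomology_zero :: "nat \<Rightarrow> ('k::field fk3_tensor \<Rightarrow> 'k) set" where
  "fk3_cohomology_zero n = fk3_cohomologous n `` {\<lambda>t. 0}"

end

theory Submission
  imports Defs
begin

text \<open>Write \<open>B\<close> for the algebra, \<open>\<epsilon>\<close> for its counit and \<open>a, b, c\<close> for the generators belonging to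
  (12), (23), (13), so that the relations become \<open>a\<^sup>2 = b\<^sup>2 = c\<^sup>2 = 0\<close>, \<open>ab = bc + ca\<close>, \<open>ba = cb + ac\<close>.

  A 3-cocycle \<open>f\<close>, regarded as a 2-cocycle with values in the dual of the augmentation ideal
  \<open>B\<^sup>+ = ker \<epsilon>\<close>, describes a square-zero extension of \<open>B\<close>; it is a coboundary as soon as this extension
  has an algebra section. Since \<open>B\<close> is given by generators and relations, the section that lifts every
  generator \<open>x\<close> to \<open>(x, 0)\<close> exists if and only if every relator
  \<open>\<Sum> \<lambda>\<^bsub>xy\<^esub> xy\<close> satisfies \<open>\<Sum> \<lambda>\<^bsub>xy\<^esub> f(x, y, z) = 0\<close> for all \<open>z \<in> B\<^sup>+\<close>. Concretely, the section is a
  2-cochain \<open>h\<close> with \<open>h(xy, z) = f(x, y, z)\<close> for every generator \<open>x\<close> and every \<open>y \<in> B\<close>, defined on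
  words and compatible with the ideal of relations by these five identities.

  The five identities are where the Yetter-Drinfeld structure enters. Being a comodule map, \<open>f\<close> kills
  every tensor of \<open>S\<^sub>3\<close>-degree different from 1, and \<open>B\<close> is spanned by twelve homogeneous monomials.
  For the relators \<open>x\<^sup>2\<close> only \<open>f(x, x, z)\<close> with \<open>z\<close> in the top degree survives. The top monomial is
  a multiple \<open>xu\<close>, and the cocycle condition on \<open>(x, x, x, u)\<close> gives \<open>f(x, x, xu) = 0\<close>
  (\<open>square_relator_zero\<close>). For the other two relators there remain a few values in degree two. The
  cocycle condition on two elements of \<open>R \<otimes> V \<inter> V \<otimes> R\<close>, with \<open>V\<close> the span of the generators and
  \<open>R\<close> the space of relators, relates these values to each other (\<open>koszul_syzygies\<close>), and together
  with the invariance of \<open>f\<close> under (13) and (12) this forces all of them to vanish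
  (\<open>relator_form_ab_degree_two\<close>, from which the relator of \<open>ba\<close> follows by symmetry).

  As \<open>h\<close> is built from values of \<open>f\<close> alone, it inherits invariance and the vanishing outside
  \<open>S\<^sub>3\<close>-degree 1, so it is a Yetter-Drinfeld cochain.\<close>


section \<open>A homogeneous spanning set\<close>

abbreviation xa :: "'k::field fk3" where "xa \<equiv> fk3_x T12"
abbreviation xb :: "'k::field fk3" where "xb \<equiv> fk3_x T23"
abbreviation xc :: "'k::field fk3" where "xc \<equiv> fk3_x T13"

definition monomial :: "tr list \<Rightarrow> 'k::field fk3" where
  "monomial ts = prod_list (map fk3_x ts)"

lemma monomial_simps [simp]: "monomial [] = 1" "monomial (t # ts) = fk3_x t * monomial ts"
  by (simp_all add: monomial_def)

text \<open>Left multiplication by the generators on the spanning monomials of \<open>fk3_spanning_words\<close>, oriented as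
  terminating rewrite rules. All of them come from the quadratic relations, multiplied by
  generators on the left or on the right.\<close>

lemma fk3_left_mult_table:
  "xa * (xa * y) = (0 :: 'k::field fk3)" "xb * (xb * y) = (0 :: 'k fk3)" "xc * (xc * y) = (0 :: 'k fk3)"
  "xa * xc = xb * xa - xc * (xb :: 'k fk3)"
  "xc * xa = xa * xb - xb * (xc :: 'k fk3)"
  "xa * (xc * xb) = xa * (xb * (xa :: 'k fk3))"
  "xb * (xc * xb) = - (xc * (xa * (xb :: 'k fk3)))"
  "xb * (xa * xb) = xa * (xb * (xa :: 'k fk3))"
  "xc * (xb * xa) = xa * (xb * (xc :: 'k fk3))"
  "xc * (xb * xc) = xc * (xa * (xb :: 'k fk3))"
  "xb * (xc * (xa * xb)) = (0 :: 'k fk3)"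
  "xb * (xa * (xb * xc)) = xa * (xc * (xa * (xb :: 'k fk3)))"
  "xb * (xa * (xb * xa)) = (0 :: 'k fk3)"
  "xb * (xa * (xc * (xa * xb))) = (0 :: 'k fk3)"
  "xc * (xa * (xb * xc)) = (0 :: 'k fk3)"
  "xc * (xa * (xb * xa)) = - (xa * (xc * (xa * (xb :: 'k fk3))))"
  "xc * (xa * (xc * (xa * xb))) = (0 :: 'k fk3)"
proof -
  have r: "xa * xa = (0 :: 'k fk3)" "xb * xb = (0 :: 'k fk3)" "xc * xc = (0 :: 'k fk3)"
    "xa * xb = xb * xc + xc * (xa :: 'k fk3)" "xb * xa = xc * xb + xa * (xc :: 'k fk3)"
    by (simp_all add: fk3_relations)
  show aa: "xa * (xa * y) = 0" and bb: "xb * (xb * y) = 0" and cc: "xc * (xc * y) = 0" for y :: "'k fk3"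
    using r(1-3) by (simp_all add: mult.assoc[symmetric])
  show ac: "xa * xc = xb * xa - xc * (xb :: 'k fk3)" and ca: "xc * xa = xa * xb - xb * (xc :: 'k fk3)"
    using r(4,5) by simp_all
  note dist = distrib_left distrib_right mult.assoc r(1-3) mult_zero_left mult_zero_right
    add_0_left add_0_right aa bb cc
  show acb: "xa * (xc * xb) = xa * (xb * (xa :: 'k fk3))"
    using arg_cong[OF r(5), of "\<lambda>y. xa * y"] by (simp only: dist)
  show bcb: "xb * (xc * xb) = - (xc * (xa * (xb :: 'k fk3)))"
    using arg_cong[OF r(4), of "\<lambda>y. y * xb"] by (simp only: dist eq_neg_iff_add_eq_0)
  have "xb * (xa * xb) = xb * (xc * (xa :: 'k fk3))"
    using arg_cong[OF r(4), of "\<lambda>y. xb * y"] by (simp only: dist)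
  moreover have "xa * (xb * xa) = xb * (xc * (xa :: 'k fk3))"
    using arg_cong[OF r(4), of "\<lambda>y. y * xa"] by (simp only: dist)
  ultimately show bab: "xb * (xa * xb) = xa * (xb * (xa :: 'k fk3))" by simp
  have cac: "xa * (xb * xc) = xc * (xa * (xc :: 'k fk3))"
    using arg_cong[OF r(4), of "\<lambda>y. y * xc"] by (simp only: dist)
  show cba: "xc * (xb * xa) = xa * (xb * (xc :: 'k fk3))"
    using arg_cong[OF r(5), of "\<lambda>y. xc * y"] by (simp only: dist cac)
  show cbc: "xc * (xb * xc) = xc * (xa * (xb :: 'k fk3))"
    using arg_cong[OF r(4), of "\<lambda>y. xc * y"] by (simp only: dist)
  have "xb * (xc * xb) + xb * (xa * xc) = (0 :: 'k fk3)"
    using arg_cong[OF r(5), of "\<lambda>y. xb * y"] by (simp only: dist)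
  then have bac: "xb * (xa * xc) = xc * (xa * (xb :: 'k fk3))"
    by (simp only: bcb neg_eq_iff_add_eq_0[symmetric] minus_minus)
  show "xb * (xc * (xa * xb)) = (0 :: 'k fk3)"
    by (simp only: bac[symmetric] bb)
  have bab': "xb * (xa * (xb * y)) = xa * (xb * (xa * y))" for y :: "'k fk3"
    using arg_cong[OF bab, of "\<lambda>u. u * y"] by (simp only: mult.assoc)
  show babc: "xb * (xa * (xb * xc)) = xa * (xc * (xa * (xb :: 'k fk3)))"
    by (simp only: bab' bac)
  show "xb * (xa * (xb * xa)) = (0 :: 'k fk3)"
    by (simp only: bab' r(1) mult_zero_right)
  show "xb * (xa * (xc * (xa * xb))) = (0 :: 'k fk3)"
    by (simp only: babc[symmetric] bb)
  show "xc * (xa * (xb * xc)) = (0 :: 'k fk3)"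
    by (simp only: cba[symmetric] cc)
  have "xc * (xa * (xc * xb)) = xa * (xb * (xc * (xb :: 'k fk3)))"
    using arg_cong[OF cac, of "\<lambda>u. u * xb"] by (simp only: mult.assoc)
  then show caba: "xc * (xa * (xb * xa)) = - (xa * (xc * (xa * (xb :: 'k fk3))))"
    by (simp only: acb bcb mult_minus_right)
  have "xa * (xc * (xa * xb)) = - (xc * (xa * (xb * (xa :: 'k fk3))))"
    by (simp only: caba minus_minus)
  then show "xc * (xa * (xc * (xa * xb))) = (0 :: 'k fk3)"
    by (simp only: mult_minus_right cc minus_zero)
qed

definition fk3_spanning_words :: "tr list set" where
  "fk3_spanning_words = {[], [T12], [T23], [T13], [T23, T12], [T13, T23], [T12, T23], [T23, T13],
     [T13, T12, T23], [T12, T23, T13], [T12, T23, T12], [T12, T13, T12, T23]}"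

text \<open>The span contains 1 and is closed under left multiplication by the generators.\<close>

lemma span_fk3_spanning_words: "fk3.span (monomial ` fk3_spanning_words) = (UNIV :: 'k::field fk3 set)"
proof -
  define S :: "'k fk3 set" where "S = fk3.span (monomial ` fk3_spanning_words)"
  have base: "monomial ts \<in> S" if "ts \<in> fk3_spanning_words" for ts
    using that unfolding S_def by (intro fk3.span_base imageI)
  have B: "1 \<in> S" "xa \<in> S" "xb \<in> S" "xc \<in> S" "xb * xa \<in> S" "xc * xb \<in> S"
    "xa * xb \<in> S" "xb * xc \<in> S" "xc * (xa * xb) \<in> S" "xa * (xb * xc) \<in> S" "xa * (xb * xa) \<in> S"
    "xa * (xc * (xa * xb)) \<in> S"
    using base[of "[]"] base[of "[T12]"] base[of "[T23]"] base[of "[T13]"] base[of "[T23, T12]"]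
      base[of "[T13, T23]"] base[of "[T12, T23]"] base[of "[T23, T13]"] base[of "[T13, T12, T23]"]
      base[of "[T12, T23, T13]"] base[of "[T12, T23, T12]"] base[of "[T12, T13, T12, T23]"]
    by (simp_all add: fk3_spanning_words_def)
  have zero: "0 \<in> S"
    unfolding S_def by (rule fk3.span_zero)
  have closed: "y + z \<in> S" "y - z \<in> S" "- y \<in> S" "fk3_scale c y \<in> S"
    if "y \<in> S" "z \<in> S" for c y z
    using that unfolding S_def
    by (blast intro: fk3.span_add fk3.span_diff fk3.span_neg fk3.span_scale)+
  have step: "fk3_x t * monomial ts \<in> S" if "ts \<in> fk3_spanning_words" for t ts
    using that B zero unfolding fk3_spanning_words_def
    by (cases t) (auto simp: fk3_relations(1-3) fk3_left_mult_table intro!: closed(2,3))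
  have "y \<in> S" for y :: "'k fk3"
  proof (induction y rule: fk3_induct)
    case one
    show ?case by (rule B(1))
  next
    case (x t y)
    then have "y \<in> fk3.span (monomial ` fk3_spanning_words)" by (simp only: S_def)
    then show ?case
    proof (induction rule: fk3.span_induct_alt)
      case base
      show ?case by (simp add: zero)
    next
      case (step c y z)
      then show ?case
        using \<open>\<And>ts t. ts \<in> fk3_spanning_words \<Longrightarrow> fk3_x t * monomial ts \<in> S\<close>
        by (auto simp: distrib_left fk3_scale_mult(2)[symmetric] intro!: closed)
    qed
  qed (simp_all add: closed)
  then show ?thesis unfolding S_def by blast
qed

text \<open>The form of the spanning result used below: \<open>L\<close> and \<open>z \<mapsto> \<epsilon>(z) L(1)\<close> agree on the twelve
  monomials, because the non-empty ones have counit 0.\<close>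

lemma linear_form_vanishes_on_augmentation_ideal:
  fixes L :: "'k::field fk3 \<Rightarrow> 'k"
  assumes add: "\<And>y z. L (y + z) = L y + L z" and scale: "\<And>c y. L (fk3_scale c y) = c * L y"
    and zero: "\<And>ts. ts \<in> fk3_spanning_words \<Longrightarrow> ts \<noteq> [] \<Longrightarrow> L (monomial ts) = 0"
    and z: "fk3_counit z = 0"
  shows "L z = 0"
proof -
  have "z \<in> fk3.span (monomial ` fk3_spanning_words)" by (simp add: span_fk3_spanning_words)
  then have "L z = fk3_counit z * L 1"
  proof (induction rule: fk3.span_induct_alt)
    case base
    show ?case using scale[of 0 0] by simp
  next
    case (step c y z)
    then obtain ts where ts: "y = monomial ts" "ts \<in> fk3_spanning_words" by blast
    have "L y = fk3_counit y * L 1"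
      using zero[OF ts(2)] ts(1) by (cases ts) simp_all
    with step.IH show ?case by (simp add: add scale distrib_right)
  qed
  with z show ?thesis by simp
qed

lemma fk3_monomial_induct [case_names monomial add scale]:
  fixes y :: "'k::field fk3"
  assumes "\<And>ts. P (monomial ts)" "\<And>y z. P y \<Longrightarrow> P z \<Longrightarrow> P (y + z)" "\<And>c y. P y \<Longrightarrow> P (fk3_scale c y)"
  shows "P y"
proof -
  have "y \<in> fk3.span (monomial ` fk3_spanning_words)" by (simp add: span_fk3_spanning_words)
  then show ?thesis
  proof (induction rule: fk3.span_induct_alt)
    case base
    show ?case using assms(3)[OF assms(1), of 0 "[]"] by simp
  qed (use assms in auto)
qed

section \<open>Degrees in the symmetric group\<close>

definition homogeneous :: "s3 \<Rightarrow> 'k::field fk3 \<Rightarrow> bool" where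
  "homogeneous d y \<longleftrightarrow> (\<forall>g. fk3_coact y g = (if g = d then y else 0))"

lemma homogeneous_mult:
  assumes "homogeneous d y" "homogeneous e z"
  shows "homogeneous (d * e) (y * z)"
  unfolding homogeneous_def
proof
  fix g
  have "fk3_coact (y * z) g = (\<Sum>h\<in>UNIV. if h = d then y * fk3_coact z (inverse h * g) else 0)"
    unfolding fk3_coact_mult using assms(1) by (intro sum.cong) (auto simp: homogeneous_def)
  also have "\<dots> = y * fk3_coact z (inverse d * g)" by simp
  also have "\<dots> = (if g = d * e then y * z else 0)"
    using assms(2) by (auto simp: homogeneous_def mult.assoc[symmetric])
  finally show "fk3_coact (y * z) g = (if g = d * e then y * z else 0)" .
qed

lemma homogeneous_monomial: "homogeneous (prod_list (map tr_perm ts)) (monomial ts)"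
proof (induction ts)
  case Nil
  show ?case by (simp add: homogeneous_def)
next
  case (Cons t ts)
  have "homogeneous (tr_perm t) (fk3_x t :: 'a fk3)" by (simp add: homogeneous_def)
  from homogeneous_mult[OF this Cons] show ?case by simp
qed

lemma coact_list_homogeneous:
  assumes "list_all2 homogeneous ds ys"
  shows "coact_list ys g = (if g = prod_list ds then tprod ys else 0)"
  using assms
proof (induction arbitrary: g rule: list_all2_induct)
  case (Cons d ds y ys)
  have "coact_list (y # ys) g
    = (\<Sum>h\<in>UNIV. if h = d then tensor_cons y (coact_list ys (inverse h * g)) else 0)"
    unfolding coact_list.simps using Cons(1) by (intro sum.cong) (auto simp: homogeneous_def)
  also have "\<dots> = tensor_cons y (coact_list ys (inverse d * g))" by simp
  also have "\<dots> = (if g = d * prod_list ds then tprod (y # ys) else 0)"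
  proof -
    have "inverse d * g = prod_list ds \<longleftrightarrow> g = d * prod_list ds"
      by (metis s3_mult_inverse(3,4))
    then show ?thesis by (simp add: Cons.IH)
  qed
  finally show ?case by simp
qed simp

lemma coact_list_monomials:
  "coact_list (map monomial tss) g
    = (if g = prod_list (map tr_perm (concat tss)) then tprod (map monomial tss) else 0)"
proof -
  have "list_all2 homogeneous (map (\<lambda>ts. prod_list (map tr_perm ts)) tss)
      (map monomial tss :: 'a fk3 list)"
    by (induction tss) (simp_all add: homogeneous_monomial)
  moreover have "prod_list (map (\<lambda>ts. prod_list (map tr_perm ts)) tss) = prod_list (map tr_perm (concat tss))"
    by (induction tss) simp_all
  ultimately show ?thesis using coact_list_homogeneous by metis
qed

text \<open>Tensors of monomials are homogeneous, so identities involving the coaction need to be verified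
  only on them.\<close>

lemma tensor_monomial_induct [case_names monomials add scale]:
  fixes t :: "'k::field fk3_tensor"
  assumes monomials: "\<And>tss. P (tprod (map monomial tss))"
    and add: "\<And>x y. P x \<Longrightarrow> P y \<Longrightarrow> P (x + y)"
    and scale: "\<And>c x. P x \<Longrightarrow> P (tensor_scale c x)"
  shows "P t"
proof -
  define S :: "'k fk3_tensor set" where "S = tensor.span (range (\<lambda>tss. tprod (map monomial tss)))"
  have cons: "tensor_cons y x \<in> S" if "x \<in> S" for x y
  proof (induction y rule: fk3_monomial_induct)
    case (monomial ts)
    from that show ?case
      unfolding S_def
    proof (induction rule: tensor.span_induct_alt)
      case (step c x y)
      then obtain tss where "x = tprod (map monomial tss)" by blast
      then have "tensor_cons (monomial ts) x = tprod (map monomial (ts # tss))" by simp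
      then have "tensor_cons (monomial ts) x \<in> tensor.span (range (\<lambda>tss. tprod (map monomial tss)))"
        by (metis rangeI tensor.span_base)
      with step.IH show ?case by (simp add: tensor.span_add tensor.span_scale)
    qed (simp add: tensor.span_zero)
  qed (simp_all add: S_def tensor.span_add tensor.span_scale)
  have "t \<in> S"
  proof (induction t rule: tensor_induct)
    case (tprod ys)
    show ?case
    proof (induction ys)
      case Nil
      have "tprod (map monomial []) \<in> S" unfolding S_def by (intro tensor.span_base rangeI)
      then show ?case by simp
    next
      case (Cons y ys)
      from cons[OF this, of y] show ?case by simp
    qed
  qed (simp_all add: S_def tensor.span_add tensor.span_scale)
  then show ?thesis
    unfolding S_def
  proof (induction rule: tensor.span_induct_alt)
    case base
    show ?case using scale[OF monomials, of 0 "[]"] by simp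
  qed (use assms in auto)
qed

lemma s3_eq_one_iff: "(g :: s3) = 1 \<longleftrightarrow> apply g I1 = I1 \<and> apply g I2 = I2 \<and> apply g I3 = I3"
  by (auto intro!: perm_eqI) (metis idx.exhaust)

lemma tprod_zero [simp]: "tprod (u @ 0 # v) = 0"
  using tprod_slot(2)[of u 0 0 v] by simp

lemma tprod_uminus [simp]: "tprod (u @ (- y) # v) = - tprod (u @ y # v)"
  using tprod_slot(1)[of u y "- y" v] by (simp add: eq_neg_iff_add_eq_0 add.commute)

lemma tprod_diff [simp]: "tprod (u @ (y - z) # v) = tprod (u @ y # v) - tprod (u @ z # v)"
  using tprod_slot(1)[of u y "- z" v] by simp

lemma abs_fk3_single: "abs_fk3 (Poly_Mapping.single w c) = fk3_scale c (monomial (letters w))"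
proof -
  have "abs_fk3 (Poly_Mapping.single (Word ts) 1) = (monomial ts :: 'a fk3)" for ts
  proof (induction ts)
    case Nil
    then show ?case by (simp add: one_fk3_def zero_word_def[symmetric])
  next
    case (Cons t ts)
    have "Poly_Mapping.single (Word (t # ts)) 1 = gen t * Poly_Mapping.single (Word ts) (1::'a)"
      by (simp add: gen_def mult_single plus_word_def)
    with Cons show ?case by (simp add: fk3_x_def times_fk3.abs_eq[symmetric])
  qed
  from this[of "letters w"] show ?thesis
    using fk3_scale.abs_eq[of c "Poly_Mapping.single w 1"] by (simp add: mult_single)
qed

section \<open>Cochains\<close>

lemma fk3_cochain_linear:
  assumes "f \<in> fk3_cochains n"
  shows "f (s + t) = f s + f t" "f (s - t) = f s - f t" "f (- t) = - f t" "f 0 = 0"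
    "f (tensor_scale c t) = c * f t"
proof -
  have lin: "Vector_Spaces.linear tensor_scale (*) f"
    using assms by (simp add: fk3_cochains_def yd_hom_def)
  show "f (s + t) = f s + f t" "f (s - t) = f s - f t" "f (- t) = - f t" "f 0 = 0"
    "f (tensor_scale c t) = c * f t"
    using lin[unfolded linear_iff_module_hom]
    by (simp_all add: module_hom.add module_hom.diff module_hom.neg module_hom.zero module_hom.scale)
qed

lemmas face_map_linear =
  module_hom.add[OF linear_tensor_counit_last[unfolded linear_iff_module_hom]]
  module_hom.scale[OF linear_tensor_counit_last[unfolded linear_iff_module_hom]]
  module_hom.add[OF linear_tensor_counit_first[unfolded linear_iff_module_hom]]
  module_hom.scale[OF linear_tensor_counit_first[unfolded linear_iff_module_hom]]
  module_hom.add[OF linear_tensor_mult[unfolded linear_iff_module_hom]]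
  module_hom.scale[OF linear_tensor_mult[unfolded linear_iff_module_hom]]

text \<open>A comodule map to the trivial module lives in degree 1 only. As transpositions are odd, it
  thus kills all tensors of monomials of odd total length.\<close>

lemma fk3_cochain_vanishes_off_identity:
  assumes "f \<in> fk3_cochains n" "prod_list (map tr_perm (concat tss)) \<noteq> 1"
  shows "f (tprod (map monomial tss)) = 0"
proof -
  have "f (tensor_coact (tprod (map monomial tss)) (prod_list (map tr_perm (concat tss))))
      = triv_coact (f (tprod (map monomial tss))) (prod_list (map tr_perm (concat tss)))"
    using assms(1) unfolding fk3_cochains_def yd_hom_def by blast
  with assms(2) show ?thesis by (simp add: coact_list_monomials triv_coact_def)
qed

lemma tr_conj_T13:
  "tr_conj (tr_perm T13) T12 = T23" "tr_conj (tr_perm T13) T23 = T12" "tr_conj (tr_perm T13) T13 = T13"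
  by (rule tr_conj_eqI, unfold tr_perm_def swap_conj, simp add: swap_sym)+

lemma tr_conj_T12:
  "tr_conj (tr_perm T12) T12 = T12" "tr_conj (tr_perm T12) T23 = T13" "tr_conj (tr_perm T12) T13 = T23"
  by (rule tr_conj_eqI, unfold tr_perm_def swap_conj, simp add: swap_sym)+

lemma fk3_act_T13:
  "fk3_act (tr_perm T13) xa = - xb" "fk3_act (tr_perm T13) xb = - xa" "fk3_act (tr_perm T13) xc = - xc"
  by (simp_all only: fk3_act_simps tr_conj_T13) (simp_all add: chi_def tr_perm_def less_idx_def)

lemma fk3_act_T12:
  "fk3_act (tr_perm T12) xa = - xa" "fk3_act (tr_perm T12) xb = xc" "fk3_act (tr_perm T12) xc = xb"
  by (simp_all only: fk3_act_simps tr_conj_T12) (simp_all add: chi_def tr_perm_def less_idx_def)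


section \<open>A 3-cocycle vanishes on the relators\<close>

locale fk3_three_cocycle =
  fixes f :: "'k::field fk3_tensor \<Rightarrow> 'k"
  assumes f: "f \<in> fk3_cocycles 3"
begin

lemma f_cochain: "f \<in> fk3_cochains 3"
  using f by (simp add: fk3_cocycles_def)

definition F :: "'k fk3 \<Rightarrow> 'k fk3 \<Rightarrow> 'k fk3 \<Rightarrow> 'k" where
  "F x y z = f (tprod [x, y, z])"

lemma F_simps [simp]:
  "F (u + v) y z = F u y z + F v y z" "F x (u + v) z = F x u z + F x v z" "F x y (u + v) = F x y u + F x y v"
  "F (u - v) y z = F u y z - F v y z" "F x (u - v) z = F x u z - F x v z" "F x y (u - v) = F x y u - F x y v"
  "F (- u) y z = - F u y z" "F x (- u) z = - F x u z" "F x y (- u) = - F x y u"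
  "F 0 y z = 0" "F x 0 z = 0" "F x y 0 = 0"
  "F (fk3_scale c u) y z = c * F u y z" "F x (fk3_scale c u) z = c * F x u z" "F x y (fk3_scale c u) = c * F x y u"
proof -
  note slots = tprod_slot[of "[]"] tprod_slot[of "[x]" for x] tprod_slot[of "[x, y]" for x y]
    tprod_diff[of "[]"] tprod_diff[of "[x]" for x] tprod_diff[of "[x, y]" for x y]
    tprod_uminus[of "[]"] tprod_uminus[of "[x]" for x] tprod_uminus[of "[x, y]" for x y]
    tprod_zero[of "[]"] tprod_zero[of "[x]" for x] tprod_zero[of "[x, y]" for x y]
  show
  "F (u + v) y z = F u y z + F v y z" "F x (u + v) z = F x u z + F x v z" "F x y (u + v) = F x y u + F x y v"
  "F (u - v) y z = F u y z - F v y z" "F x (u - v) z = F x u z - F x v z" "F x y (u - v) = F x y u - F x y v"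
  "F (- u) y z = - F u y z" "F x (- u) z = - F x u z" "F x y (- u) = - F x y u"
  "F 0 y z = 0" "F x 0 z = 0" "F x y 0 = 0"
  "F (fk3_scale c u) y z = c * F u y z" "F x (fk3_scale c u) z = c * F x u z" "F x y (fk3_scale c u) = c * F x y u"
    by (simp_all add: F_def slots[unfolded append.simps] fk3_cochain_linear[OF f_cochain])
qed

lemma F_cocycle:
  "F u x y * fk3_counit z - F u x (y * z) + F u (x * y) z - F (u * x) y z + fk3_counit u * F x y z = 0"
proof -
  have "fk3_diff 3 f (tprod [u, x, y, z]) = 0" using f by (simp add: fk3_cocycles_def)
  then show ?thesis
    by (simp add: fk3_diff_def tensor_counit_last_tprod tensor_counit_first_tprod tensor_mult_tprod
        numeral_3_eq_3 lessThan_Suc fk3_cochain_linear[OF f_cochain] F_def algebra_simps)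
qed

lemma F_cocycle_augmented:
  assumes "fk3_counit u = 0" "fk3_counit z = 0"
  shows "F u x (y * z) = F u (x * y) z - F (u * x) y z"
  using F_cocycle[of u x y z] assms by (simp add: algebra_simps)

lemma F_invariant: "F (fk3_act g x) (fk3_act g y) (fk3_act g z) = F x y z"
proof -
  have "f (tensor_act g (tprod [x, y, z])) = f (tprod [x, y, z])"
    using f_cochain unfolding fk3_cochains_def yd_hom_def triv_act_def by blast
  then show ?thesis by (simp add: F_def)
qed

lemma F_monomials_zero:
  "prod_list (map tr_perm (r @ s @ t)) \<noteq> 1 \<Longrightarrow> F (monomial r) (monomial s) (monomial t) = 0"
  using fk3_cochain_vanishes_off_identity[OF f_cochain, of "[r, s, t]"] by (simp add: F_def)

text \<open>Among the non-empty spanning monomials only the top one has \<open>S\<^sub>3\<close>-degree 1, and it can be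
  written as \<open>aA = bB = cC\<close> with \<open>A, B, C\<close> of length three. For a generator \<open>x\<close> the cocycle condition on \<open>(x, x, x, u)\<close> reads
  \<open>f(x, x, xu) = 0\<close> because \<open>x\<^sup>2 = 0\<close>.\<close>

lemma square_relator_zero:
  assumes "fk3_counit z = 0"
  shows "F (fk3_x t) (fk3_x t) z = 0"
proof (rule linear_form_vanishes_on_augmentation_ideal[OF _ _ _ assms])
  fix ts
  assume ts: "ts \<in> fk3_spanning_words" "ts \<noteq> []"
  have sq: "fk3_x t * fk3_x t = (0 :: 'k fk3)"
    by (cases t) (simp_all add: fk3_relations)
  have left: "F (fk3_x t) (fk3_x t) (fk3_x t * z) = 0" if "fk3_counit z = 0" for z
    by (simp add: F_cocycle_augmented that sq)
  show "F (fk3_x t) (fk3_x t) (monomial ts) = 0"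
  proof (cases "ts = [T12, T13, T12, T23]")
    case True
    have top: "monomial ts = xa * (xc * (xa * (xb :: 'k fk3)))" "monomial ts = xb * (xa * (xb * (xc :: 'k fk3)))"
      "monomial ts = xc * (- (xa * (xb * (xa :: 'k fk3))))"
      by (simp_all add: True fk3_left_mult_table)
    have neg: "fk3_counit (- y) = 0" if "fk3_counit y = 0" for y :: "'k fk3"
      using fk3_counit_simps(6)[of "- 1" y] that by simp
    have "fk3_counit (xc * (xa * (xb :: 'k fk3))) = 0" "fk3_counit (xa * (xb * (xc :: 'k fk3))) = 0"
      "fk3_counit (- (xa * (xb * (xa :: 'k fk3)))) = 0"
      by (simp_all add: neg)
    then have "\<exists>z :: 'k fk3. fk3_counit z = 0 \<and> monomial ts = fk3_x t * z"
      using top by (cases t) blast+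
    with left show ?thesis by auto
  next
    case False
    with ts have "prod_list (map tr_perm ts) \<noteq> 1"
      by (auto simp: fk3_spanning_words_def s3_eq_one_iff tr_perm_def apply_times)
    then show ?thesis
      using F_monomials_zero[of "[t]" "[t]" ts] by (simp add: mult.assoc[symmetric])
  qed
qed simp_all

definition relator_form_ab :: "'k fk3 \<Rightarrow> 'k" where
  "relator_form_ab z = F xa xb z - F xb xc z - F xc xa z"

definition relator_form_ba :: "'k fk3 \<Rightarrow> 'k" where
  "relator_form_ba z = F xb xa z - F xc xb z - F xa xc z"

text \<open>With \<open>r\<^sub>1 = ab - bc - ca\<close> and \<open>r\<^sub>2 = ba - cb - ac\<close>, the elements
  \<open>r\<^sub>1c - r\<^sub>2a - a\<^sup>2b - c\<^sup>2b = - ar\<^sub>1 + cr\<^sub>2 - bc\<^sup>2 - ba\<^sup>2\<close> and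
  \<open>r\<^sub>1b - r\<^sub>2c + b\<^sup>2a + c\<^sup>2a = br\<^sub>2 - cr\<^sub>1 + ab\<^sup>2 + ac\<^sup>2\<close> of the free algebra lie in
  \<open>R \<otimes> V \<inter> V \<otimes> R\<close>. Summing the cocycle condition on \<open>(x, y, w, z)\<close> over the words \<open>xyw\<close>
  of such an element leaves only the terms \<open>f(x, y, wz)\<close>.\<close>

lemma koszul_syzygies:
  assumes "fk3_counit z = 0"
  shows "relator_form_ab (xc * z) - relator_form_ba (xa * z) = F xa xa (xb * z) + F xc xc (xb * z)"
    "relator_form_ab (xb * z) - relator_form_ba (xc * z) = - F xb xb (xa * z) - F xc xc (xa * z)"
  using assms by (simp_all add: relator_form_ab_def relator_form_ba_def F_cocycle_augmented fk3_relations)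

lemma relator_form_ab_vanishes_off_identity:
  assumes "prod_list (map tr_perm ([T12, T23] @ ts)) \<noteq> 1"
  shows "relator_form_ab (monomial ts) = 0"
proof -
  have "tr_perm T23 * tr_perm T13 = tr_perm T12 * tr_perm T23"
    "tr_perm T13 * tr_perm T12 = tr_perm T12 * tr_perm T23"
    by (rule perm_eqI; case_tac a; simp add: tr_perm_def apply_times)+
  then have "prod_list (map tr_perm ([T23, T13] @ ts)) = prod_list (map tr_perm ([T12, T23] @ ts))"
    "prod_list (map tr_perm ([T13, T12] @ ts)) = prod_list (map tr_perm ([T12, T23] @ ts))"
    by (simp_all add: mult.assoc[symmetric])
  with assms show ?thesis
    using F_monomials_zero[of "[T12]" "[T23]" ts] F_monomials_zero[of "[T23]" "[T13]" ts]
      F_monomials_zero[of "[T13]" "[T12]" ts]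
    by (simp add: relator_form_ab_def)
qed

lemma relator_form_linear [simp]:
  "relator_form_ab (y + z) = relator_form_ab y + relator_form_ab z" "relator_form_ab (y - z) = relator_form_ab y - relator_form_ab z" "relator_form_ab (- z) = - relator_form_ab z" "relator_form_ab 0 = 0"
  "relator_form_ab (fk3_scale c z) = c * relator_form_ab z"
  "relator_form_ba (y + z) = relator_form_ba y + relator_form_ba z" "relator_form_ba (y - z) = relator_form_ba y - relator_form_ba z" "relator_form_ba (- z) = - relator_form_ba z" "relator_form_ba 0 = 0"
  "relator_form_ba (fk3_scale c z) = c * relator_form_ba z"
  by (simp_all add: relator_form_ab_def relator_form_ba_def algebra_simps)

text \<open>The permutations (13) and (12) interchange the two non-monomial relators.\<close>

lemma relator_form_T13: "relator_form_ab (fk3_act (tr_perm T13) z) = relator_form_ba z"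
  using F_invariant[of "tr_perm T13" xb xa z] F_invariant[of "tr_perm T13" xc xb z]
    F_invariant[of "tr_perm T13" xa xc z]
  by (simp add: relator_form_ab_def relator_form_ba_def fk3_act_T13 del: fk3_act_simps(6))

lemma relator_form_T12: "relator_form_ab (fk3_act (tr_perm T12) z) = relator_form_ba z"
  using F_invariant[of "tr_perm T12" xb xa z, symmetric] F_invariant[of "tr_perm T12" xc xb z, symmetric]
    F_invariant[of "tr_perm T12" xa xc z, symmetric]
  by (simp add: relator_form_ab_def relator_form_ba_def fk3_act_T12 del: fk3_act_simps(6))

text \<open>Write \<open>\<phi>\<^sub>1, \<phi>\<^sub>2\<close> for the two relator forms. The syzygies give \<open>\<phi>\<^sub>1(cb) = \<phi>\<^sub>2(ab)\<close> and
  \<open>\<phi>\<^sub>1(ba) = \<phi>\<^sub>2(ca)\<close>, and the symmetries give \<open>\<phi>\<^sub>1(cb) = \<phi>\<^sub>2(ca)\<close> and \<open>\<phi>\<^sub>1(cb) = \<phi>\<^sub>2(bc)\<close>.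
  All of these values are thus equal to a scalar \<open>s\<close>, and \<open>ab = bc + ca\<close> yields \<open>s = s + s\<close>.\<close>

lemma relator_form_ab_degree_two: "relator_form_ab (xc * xb) = 0" "relator_form_ab (xb * xa) = 0"
proof -
  have "relator_form_ab (xc * xb) = relator_form_ba (xa * xb)"
    using koszul_syzygies(1)[of xb] by (simp add: fk3_relations)
  moreover have "relator_form_ab (xb * xa) = relator_form_ba (xc * xa)"
    using koszul_syzygies(2)[of xa] by (simp add: fk3_relations)
  moreover have "relator_form_ab (xc * xb) = relator_form_ba (xc * xa)"
    using relator_form_T13[of "xc * xa"] by (simp add: fk3_act_T13 del: fk3_act_simps(6))
  moreover have "relator_form_ab (xc * xb) = relator_form_ba (xb * xc)"
    using relator_form_T12[of "xb * xc"] by (simp add: fk3_act_T12 del: fk3_act_simps(6))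
  moreover have "relator_form_ba (xa * xb) = relator_form_ba (xb * xc) + relator_form_ba (xc * xa)"
    by (simp add: fk3_relations)
  ultimately show "relator_form_ab (xc * xb) = 0" "relator_form_ab (xb * xa) = 0" by simp_all
qed

lemma relator_form_ab_zero:
  assumes "fk3_counit z = 0"
  shows "relator_form_ab z = 0"
proof (rule linear_form_vanishes_on_augmentation_ideal[OF _ _ _ assms])
  fix ts
  assume ts: "ts \<in> fk3_spanning_words" "ts \<noteq> []"
  show "relator_form_ab (monomial ts) = 0"
  proof (cases "ts = [T13, T23] \<or> ts = [T23, T12]")
    case True
    then show ?thesis using relator_form_ab_degree_two by auto
  next
    case False
    with ts have "prod_list (map tr_perm ([T12, T23] @ ts)) \<noteq> 1"
      by (auto simp: fk3_spanning_words_def s3_eq_one_iff tr_perm_def apply_times)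
    then show ?thesis by (rule relator_form_ab_vanishes_off_identity)
  qed
qed simp_all

lemma fk3_counit_act: "fk3_counit (fk3_act g z) = fk3_counit z"
  using yd_hom_fk3_counit unfolding yd_hom_def triv_act_def by blast

lemma relator_form_ba_zero: "fk3_counit z = 0 \<Longrightarrow> relator_form_ba z = 0"
  using relator_form_T13[of z] relator_form_ab_zero[of "fk3_act (tr_perm T13) z"] by (simp add: fk3_counit_act)

section \<open>The primitive of a 3-cocycle on the augmentation ideal\<close>

text \<open>The section of the extension, on the free algebra. The value at the empty word is what the
  cocycle condition on \<open>(1, 1, y, z)\<close> prescribes if \<open>f\<close> is not normalised.\<close>

definition free_primitive :: "'k fk3 \<Rightarrow> 'k free_alg \<Rightarrow> 'k" where
  "free_primitive z = lin_ext (*) (\<lambda>w. case letters w of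
     [] \<Rightarrow> - F 1 1 z | t # ts \<Rightarrow> F (fk3_x t) (monomial ts) z)"

lemma free_primitive_linear [simp]:
  "free_primitive z 0 = 0" "free_primitive z (p + q) = free_primitive z p + free_primitive z q"
  "free_primitive z (p - q) = free_primitive z p - free_primitive z q"
  "free_primitive z (Poly_Mapping.map ((*) c) p) = c * free_primitive z p"
  by (simp_all add: free_primitive_def vector_space.lin_ext_zero[OF vector_space_mult]
      vector_space.lin_ext_add[OF vector_space_mult] vector_space.lin_ext_diff[OF vector_space_mult]
      vector_space.lin_ext_map[OF vector_space_mult])

lemma free_primitive_single:
  "free_primitive z (Poly_Mapping.single w c) = c * (case letters w of
     [] \<Rightarrow> - F 1 1 z | t # ts \<Rightarrow> F (fk3_x t) (monomial ts) z)"
  by (simp add: free_primitive_def vector_space.lin_ext_single[OF vector_space_mult])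

lemma free_primitive_gen: "free_primitive z (gen t * p) = F (fk3_x t) (abs_fk3 p) z"
proof (induction p rule: pm_single_induct)
  case zero
  show ?case by (simp add: zero_fk3_def[symmetric])
next
  case (add p w c)
  have "gen t * Poly_Mapping.single w c = Poly_Mapping.single (Word (t # letters w)) c"
    by (simp add: gen_def mult_single plus_word_def)
  with add show ?case
    by (simp add: distrib_left plus_fk3.abs_eq[symmetric] free_primitive_single abs_fk3_single)
qed

text \<open>The cocycle condition on \<open>(x, y, p, z)\<close>, summed over a relator, turns the terms
  \<open>f(x, yp, z)\<close> into \<open>f(x, y, pz)\<close>, to which the five identities apply.\<close>

lemma free_primitive_relator:
  assumes "r \<in> fk3_relators" "fk3_counit z = 0"
  shows "free_primitive z (r * p) = 0"
proof -
  have xx: "free_primitive z (gen s * (gen t * p)) = F (fk3_x s) (fk3_x t * abs_fk3 p) z" for s t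
    by (simp add: free_primitive_gen times_fk3.abs_eq[symmetric] fk3_x.abs_eq[symmetric])
  have yz: "F (fk3_x s) (fk3_x t * y) z = F (fk3_x s) (fk3_x t) (y * z) + F (fk3_x s * fk3_x t) y z" for s t y
    using F_cocycle_augmented[of "fk3_x s" z "fk3_x t" y] assms(2) by simp
  have zero: "fk3_counit (abs_fk3 p * z) = 0" using assms(2) by simp
  show ?thesis
    using assms(1) square_relator_zero[OF zero] relator_form_ab_zero[OF zero] relator_form_ba_zero[OF zero]
    by (auto simp: fk3_relators_def left_diff_distrib distrib_right mult.assoc xx yz fk3_relations
        relator_form_ab_def relator_form_ba_def diff_diff_eq)
qed

text \<open>The induction is on \<open>p\<close> times an arbitrary right factor. Left multiplication by a generator
  is harmless, since \<open>h(xq, z) = f(x, q, z)\<close> depends on the class of \<open>q\<close> only.\<close>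

lemma free_primitive_ideal:
  assumes "p \<in> fk3_ideal" "fk3_counit z = 0"
  shows "free_primitive z p = 0"
proof -
  have ideal: "abs_fk3 q = 0" if "q \<in> fk3_ideal" for q :: "'k free_alg"
    using that by (simp add: zero_fk3_def fk3.abs_eq_iff)
  have "free_primitive z (p * q) = 0" for q
    using assms(1)
  proof (induction arbitrary: q)
    case (relator r)
    then show ?case using assms(2) by (rule free_primitive_relator)
  next
    case (left p a)
    show ?case
    proof (induction a rule: pm_single_induct)
      case (add a w c)
      have "free_primitive z (Poly_Mapping.single w c * p * q) = 0"
      proof (cases "letters w")
        case Nil
        then have "w = 0" by (cases w) (simp add: zero_word_def)
        then show ?thesis
          using left.IH[of q] free_primitive_linear(4)[of z c "p * q"]
          by (simp add: mult.assoc mult_map_scale_conv_mult)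
      next
        case (Cons t ts)
        then have "Poly_Mapping.single w c = gen t * Poly_Mapping.single (Word ts) c"
          by (cases w) (simp add: gen_def mult_single plus_word_def)
        moreover have "Poly_Mapping.single (Word ts) c * p * q \<in> fk3_ideal"
          by (intro fk3_ideal.left fk3_ideal.right left.hyps)
        ultimately show ?thesis
          using ideal by (simp add: mult.assoc free_primitive_gen)
      qed
      with add show ?case by (simp add: distrib_right)
    qed simp
  next
    case (right p a)
    then show ?case by (simp add: mult.assoc)
  qed (simp_all add: distrib_right)
  from this[of 1] show ?thesis by simp
qed

definition aug_primitive :: "'k fk3 \<Rightarrow> 'k fk3 \<Rightarrow> 'k" where
  "aug_primitive y z = free_primitive z (rep_fk3 y)"

lemma aug_primitive_abs:
  assumes "fk3_counit z = 0"
  shows "aug_primitive (abs_fk3 p) z = free_primitive z p"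
proof -
  have "rep_fk3 (abs_fk3 p) - p \<in> fk3_ideal"
    by (rule Quotient3_rep_abs[OF Quotient3_fk3]) (simp add: fk3_ideal.zero)
  from free_primitive_ideal[OF this assms] show ?thesis by (simp add: aug_primitive_def)
qed

lemma fk3_abs_cases: obtains p where "y = abs_fk3 p"
  by (metis Quotient3_abs_rep[OF Quotient3_fk3])

lemma aug_primitive_left:
  assumes z: "fk3_counit z = 0"
  shows "aug_primitive 1 z = - F 1 1 z" "aug_primitive (fk3_x t * y) z = F (fk3_x t) y z"
    "aug_primitive (x + y) z = aug_primitive x z + aug_primitive y z"
    "aug_primitive (fk3_scale c y) z = c * aug_primitive y z"
proof -
  obtain p q where pq: "x = abs_fk3 p" "y = abs_fk3 q" by (metis fk3_abs_cases)
  show "aug_primitive 1 z = - F 1 1 z"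
    using aug_primitive_abs[OF z, of 1] free_primitive_single[of z 0 1]
    by (simp add: one_fk3_def)
  show "aug_primitive (fk3_x t * y) z = F (fk3_x t) y z"
    by (simp add: pq fk3_x.abs_eq times_fk3.abs_eq aug_primitive_abs[OF z] free_primitive_gen)
  show "aug_primitive (x + y) z = aug_primitive x z + aug_primitive y z"
    by (simp add: pq plus_fk3.abs_eq aug_primitive_abs[OF z])
  show "aug_primitive (fk3_scale c y) z = c * aug_primitive y z"
    by (simp add: pq fk3_scale.abs_eq aug_primitive_abs[OF z] mult_map_scale_conv_mult[symmetric])
qed

lemma aug_primitive_right:
  "aug_primitive y (z + z') = aug_primitive y z + aug_primitive y z'"
  "aug_primitive y (fk3_scale c z) = c * aug_primitive y z"
proof -
  have "free_primitive (z + z') p = free_primitive z p + free_primitive z' p" for p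
    by (induction p rule: pm_single_induct)
      (simp_all add: free_primitive_single algebra_simps split: list.split)
  then show "aug_primitive y (z + z') = aug_primitive y z + aug_primitive y z'"
    by (simp add: aug_primitive_def)
  have "free_primitive (fk3_scale c z) p = c * free_primitive z p" for p
    by (induction p rule: pm_single_induct)
      (simp_all add: free_primitive_single algebra_simps split: list.split)
  then show "aug_primitive y (fk3_scale c z) = c * aug_primitive y z"
    by (simp add: aug_primitive_def)
qed

text \<open>Induction on \<open>x\<close>: replacing \<open>x\<close> by \<open>tx\<close> for a generator \<open>t\<close>, the first two values of the
  primitive become values of \<open>f\<close>, the third has the coefficient \<open>\<epsilon>(tx) = 0\<close>, and the claim is the cocycle condition on \<open>(t, x, y, z)\<close>.\<close>

lemma aug_primitive_boundary:
  assumes z: "fk3_counit z = 0"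
  shows "F x y z = aug_primitive (x * y) z - aug_primitive x (y * z) - fk3_counit x * aug_primitive y z"
proof -
  have yz: "fk3_counit (y * z) = 0" using z by simp
  show ?thesis
  proof (induction x rule: fk3_induct)
    case one
    show ?case
      using F_cocycle[of 1 1 y z] z by (simp add: aug_primitive_left yz)
  next
    case (x t x)
    show ?case
      using F_cocycle_augmented[of "fk3_x t" z x y] z
      by (simp add: aug_primitive_left yz mult.assoc)
  next
    case (add x x')
    then show ?case
      by (simp add: distrib_right aug_primitive_left z yz)
  next
    case (scale c x)
    then show ?case
      by (simp add: fk3_scale_mult(1)[symmetric] aug_primitive_left z yz right_diff_distrib mult.assoc)
  qed
qed

lemma aug_primitive_invariant:
  assumes "fk3_counit z = 0"
  shows "aug_primitive (fk3_act g y) (fk3_act g z) = aug_primitive y z"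
proof -
  have gz: "fk3_counit (fk3_act g z) = 0" by (simp add: fk3_counit_act assms)
  show ?thesis
  proof (induction y rule: fk3_induct)
    case one
    show ?case using F_invariant[of g 1 1 z] by (simp add: aug_primitive_left assms gz)
  next
    case (x t y)
    show ?case
      using F_invariant[of g "fk3_x t" y z]
      by (simp add: aug_primitive_left assms gz fk3_scale_mult(1)[symmetric])
  qed (simp_all add: aug_primitive_left assms gz)
qed

section \<open>Extension to the whole algebra\<close>

definition aug_part :: "'k fk3 \<Rightarrow> 'k fk3" where
  "aug_part z = z - fk3_scale (fk3_counit z) 1"

lemma fk3_counit_diff: "fk3_counit (y - z) = fk3_counit y - fk3_counit (z :: 'k fk3)"
  using fk3_counit_simps(4)[of "y - z" z] by simp

lemma aug_part_simps:
  "fk3_counit (aug_part z) = 0" "aug_part (y + z) = aug_part y + aug_part z"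
  "aug_part (fk3_scale c z) = fk3_scale c (aug_part z)"
  "aug_part (y * z) = y * aug_part z + fk3_scale (fk3_counit z) (aug_part y)"
  "aug_part (fk3_act g z) = fk3_act g (aug_part z)"
  "z = aug_part z + fk3_scale (fk3_counit z) 1"
proof -
  have "fk3_act g (x - y) = fk3_act g x - fk3_act g y" for x y :: "'k fk3"
    using fk3_act_simps(3)[of g "x - y" y] by simp
  then show "aug_part (fk3_act g z) = fk3_act g (aug_part z)"
    by (simp add: aug_part_def fk3_counit_act)
  show "aug_part (y * z) = y * aug_part z + fk3_scale (fk3_counit z) (aug_part y)"
    by (simp add: aug_part_def right_diff_distrib fk3_scale_mult(2)[symmetric]
        fk3.scale_right_diff_distrib mult.commute)
qed (simp_all add: aug_part_def fk3_counit_diff fk3.scale_left_distrib fk3.scale_right_diff_distrib)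

text \<open>The second summand accounts for a constant last argument: the cocycle condition on
  \<open>(x, y, 1, 1)\<close> says that \<open>f(x, y, 1) = f(xy, 1, 1) - \<epsilon>(x) f(y, 1, 1)\<close>.\<close>

definition primitive :: "'k fk3 \<Rightarrow> 'k fk3 \<Rightarrow> 'k" where
  "primitive y z = aug_primitive y (aug_part z) + F y 1 1 * fk3_counit z"

lemma primitive_boundary:
  "F x y z = primitive x y * fk3_counit z + primitive (x * y) z - primitive x (y * z) - fk3_counit x * primitive y z"
proof -
  have "F x y z = F x y (aug_part z) + fk3_counit z * F x y 1"
    by (subst aug_part_simps(6)[of z]) simp
  moreover have "F x y 1 = F (x * y) 1 1 - fk3_counit x * F y 1 1"
    using F_cocycle[of x y 1 1] by (simp add: algebra_simps)
  ultimately show ?thesis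
    using aug_primitive_boundary[OF aug_part_simps(1), of x y z]
    by (simp add: primitive_def aug_part_simps(4) aug_primitive_right algebra_simps)
qed

definition primitive_cochain :: "'k fk3_tensor \<Rightarrow> 'k" where
  "primitive_cochain = tensor_ext (*) (\<lambda>ys. case ys of [y, z] \<Rightarrow> primitive y z | _ \<Rightarrow> 0)"

lemma primitive_bilinear:
  "primitive (x + y) z = primitive x z + primitive y z" "primitive (fk3_scale c y) z = c * primitive y z"
  "primitive x (y + z) = primitive x y + primitive x z" "primitive y (fk3_scale c z) = c * primitive y z"
  by (simp_all add: primitive_def aug_primitive_left aug_primitive_right aug_part_simps algebra_simps)

lemma primitive_cochain_tprod:
  "primitive_cochain (tprod ys) = (case ys of [y, z] \<Rightarrow> primitive y z | _ \<Rightarrow> 0)"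
proof -
  have "multilin (*) (\<lambda>ys. case ys of [y, z] \<Rightarrow> primitive y z | _ \<Rightarrow> 0)"
    unfolding multilin_def
    by (auto simp: primitive_bilinear neq_Nil_conv append_eq_Cons_conv split: list.splits)
  then show ?thesis
    by (simp add: primitive_cochain_def tensor_ext_tprod vector_space_mult)
qed

lemma primitive_vanishes_off_identity:
  assumes "prod_list (map tr_perm (u @ v)) \<noteq> 1"
  shows "primitive (monomial u) (monomial v) = 0"
proof (cases "v = []")
  case True
  then show ?thesis
    using assms F_monomials_zero[of u "[]" "[]"] aug_primitive_right(2)[of _ 0 0]
    by (simp add: primitive_def aug_part_def)
next
  case False
  then have v: "fk3_counit (monomial v :: 'k fk3) = 0" by (cases v) simp_all
  have "aug_primitive (monomial u) (monomial v) = 0"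
  proof (cases u)
    case Nil
    then show ?thesis
      using assms F_monomials_zero[of "[]" "[]" v] by (simp add: aug_primitive_left v)
  next
    case (Cons t ts)
    then show ?thesis
      using assms F_monomials_zero[of "[t]" ts v] by (simp add: aug_primitive_left v mult.assoc)
  qed
  then show ?thesis by (simp add: primitive_def aug_part_def v)
qed

lemma linear_primitive_cochain: "Vector_Spaces.linear tensor_scale (*) primitive_cochain"
  unfolding primitive_cochain_def by (rule linear_tensor_ext[OF vector_space_mult])

lemmas primitive_cochain_linear =
  module_hom.zero[OF linear_primitive_cochain[unfolded linear_iff_module_hom]]
  module_hom.add[OF linear_primitive_cochain[unfolded linear_iff_module_hom]]
  module_hom.scale[OF linear_primitive_cochain[unfolded linear_iff_module_hom]]

lemma primitive_cochain_in_cochains: "primitive_cochain \<in> fk3_cochains 2"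
proof -
  have "primitive_cochain (tensor_act g t) = primitive_cochain t" for g t
  proof (induction t rule: tensor_induct)
    case (tprod ys)
    show ?case
      by (auto simp: primitive_cochain_tprod primitive_def aug_part_simps(1,5) aug_primitive_invariant
          fk3_counit_act F_invariant[of g _ 1 1, simplified] split: list.split)
  qed (simp_all add: primitive_cochain_linear)
  moreover have "primitive_cochain (tensor_coact t g) = triv_coact (primitive_cochain t) g" for t g
  proof (induction t rule: tensor_monomial_induct)
    case (monomials tss)
    have "primitive_cochain (tprod (map monomial tss)) = 0" if "prod_list (map tr_perm (concat tss)) \<noteq> 1"
      using that primitive_vanishes_off_identity
      by (auto simp: primitive_cochain_tprod split: list.split)
    then show ?case
      by (auto simp: coact_list_monomials triv_coact_def primitive_cochain_linear)
  qed (simp_all add: primitive_cochain_linear triv_coact_def)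
  moreover have "primitive_cochain (tprod ys) = 0" if "length ys \<noteq> 2" for ys
    using that by (auto simp: primitive_cochain_tprod split: list.split)
  ultimately show ?thesis
    using linear_primitive_cochain by (simp add: fk3_cochains_def yd_hom_def triv_act_def)
qed

lemma fk3_diff_primitive_cochain: "fk3_diff 2 primitive_cochain t = f t"
proof (induction t rule: tensor_induct)
  case (tprod ys)
  show ?case
  proof (cases "length ys = 3")
    case True
    then obtain x y z where ys: "ys = [x, y, z]"
      by (auto simp: numeral_3_eq_3 length_Suc_conv)
    show ?thesis
      using primitive_boundary[of x y z]
      by (simp add: ys fk3_diff_def tensor_counit_last_tprod tensor_counit_first_tprod tensor_mult_tprod
          numeral_2_eq_2 lessThan_Suc primitive_cochain_linear primitive_cochain_tprod F_def)
  next
    case False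
    then have "f (tprod ys) = 0" using f_cochain by (simp add: fk3_cochains_def)
    moreover have "primitive_cochain (tprod zs) = 0" if "length zs \<noteq> 2" for zs
      using primitive_cochain_in_cochains that by (simp add: fk3_cochains_def)
    moreover from this False have "primitive_cochain (tensor_mult j (tprod ys)) = 0" for j
      by (simp add: tensor_mult_tprod primitive_cochain_linear)
    ultimately show ?thesis
      using False
      by (simp add: fk3_diff_def tensor_counit_last_tprod tensor_counit_first_tprod
          primitive_cochain_linear)
  qed
next
  case (add t u)
  have "fk3_diff 2 primitive_cochain (t + u)
    = fk3_diff 2 primitive_cochain t + fk3_diff 2 primitive_cochain u"
    by (simp add: fk3_diff_def primitive_cochain_linear face_map_linear sum.distrib algebra_simps)
  with add show ?case by (simp add: fk3_cochain_linear[OF f_cochain])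
next
  case (scale c t)
  have "fk3_diff 2 primitive_cochain (tensor_scale c t) = c * fk3_diff 2 primitive_cochain t"
    by (simp add: fk3_diff_def primitive_cochain_linear face_map_linear sum_distrib_left algebra_simps)
  with scale show ?case by (simp add: fk3_cochain_linear[OF f_cochain])
qed

lemma coboundary: "f \<in> fk3_coboundaries 3"
proof -
  have "f = fk3_diff 2 primitive_cochain" by (simp add: fun_eq_iff fk3_diff_primitive_cochain)
  then show ?thesis
    using primitive_cochain_in_cochains by (auto simp: fk3_coboundaries_def numeral_3_eq_3 numeral_2_eq_2)
qed

end

section \<open>Vanishing of the third cohomology\<close>

lemma fk3_cocycles_diff:
  assumes "f \<in> fk3_cocycles n" "g \<in> fk3_cocycles n"
  shows "(\<lambda>t. f t - g t) \<in> fk3_cocycles n"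
proof -
  have lin: "Vector_Spaces.linear tensor_scale (*) f" "Vector_Spaces.linear tensor_scale (*) g"
    using assms by (simp_all add: fk3_cocycles_def fk3_cochains_def yd_hom_def)
  have "Vector_Spaces.linear tensor_scale (*) (\<lambda>t. f t - g t)"
    using lin by (simp add: Vector_Spaces.linear_iff algebra_simps)
  then have "(\<lambda>t. f t - g t) \<in> fk3_cochains n"
    using assms by (simp add: fk3_cocycles_def fk3_cochains_def yd_hom_def triv_act_def triv_coact_def)
  moreover have "fk3_diff n (\<lambda>t. f t - g t) t = fk3_diff n f t - fk3_diff n g t" for t
    by (simp add: fk3_diff_def right_diff_distrib sum_subtractf)
  ultimately show ?thesis using assms by (simp add: fk3_cocycles_def)
qed

lemma fk3_zero_cocycle: "(\<lambda>t. 0) \<in> fk3_cocycles n"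
  by (simp add: fk3_cocycles_def fk3_cochains_def yd_hom_def triv_act_def triv_coact_def fk3_diff_def
      Vector_Spaces.linear_iff vector_space_tensor vector_space_mult)

theorem corollary6p6:
  shows "fk3_cohomology 3 = {fk3_cohomology_zero 3 :: ('k::field_char_0 fk3_tensor \<Rightarrow> 'k) set}"
proof -
  have "fk3_cohomologous 3 = fk3_cocycles 3 \<times> (fk3_cocycles 3 :: ('k fk3_tensor \<Rightarrow> 'k) set)"
    using fk3_three_cocycle.coboundary[unfolded fk3_three_cocycle_def, OF fk3_cocycles_diff]
    by (auto simp: fk3_cohomologous_def)
  moreover have "(\<lambda>t. 0 :: 'k) \<in> fk3_cocycles 3" by (rule fk3_zero_cocycle)
  ultimately show ?thesis
    by (auto simp: fk3_cohomology_def fk3_cohomology_zero_def quotient_def)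
qed

end
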